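(* Let $m,n\geq 2$ and let $K_{n,m}$ be the complete bipartite graph on $n$ and $m$ vertices. The bold homology $\mathbb{H}(K_{n,m})$, with coefficients in a field, is of rank $1$ in degree $2$, and trivial in all other degrees.
   Context: Bold homology. Let $G$ be a finite simple graph and $\mathbb{K}$ a field; order $V(G)$. A bi-colouring is a map $\varepsilon\colon V(G)\to\{0,1\}$, and $G_\varepsilon$ denotes the subgraph of $G$ induced by the vertices $v$ with $\varepsilon(v)=1$. Write $\varepsilon\,\widetilde{\triangleleft}\,\varepsilon'$ if $\varepsilon'$ is obtained from $\varepsilon$ by changing the value at exactly one vertex from $0$ to $1$. A sign assignment is a choice of $s(\varepsilon,\varepsilon')\in\mathbb{Z}/2$ for each such pair with $s(\varepsilon,\varepsilon_1)+s(\varepsilon_1,\varepsilon'')\equiv s(\varepsilon,\varepsilon_2)+s(\varepsilon_2,\varepsilon'')+1\pmod 2$ whenever $\varepsilon\,\widetilde{\triangleleft}\,\varepsilon_1,\varepsilon_2\,\widetilde{\triangleleft}\,\varepsilon''$, $\varepsilon_1\neq\varepsilon_2$; it exists and the choice does not affect the complex up to isomorphism. The bold chain group is \[\mathrm{C}\mathbb{H}_i(G)=\bigoplus_{\varepsilon:\ \sum_v\varepsilon(v)=i}\ \bigoplus_{x\in\pi_0(G_\varepsilon)}\mathbb{K}\langle x\rangle,\] where $\pi_0$ is the set of connected components (so $\mathrm{C}\mathbb{H}_0=0$), with differential $d^i\colon \mathrm{C}\mathbb{H}_i\to\mathrm{C}\mathbb{H}_{i+1}$ given for $x\in\pi_0(G_\varepsilon)$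 by $d^i(x)=\sum(-1)^{s(\varepsilon,\varepsilon')}y$, the sum over all $\varepsilon'$ with $\varepsilon\,\widetilde{\triangleleft}\,\varepsilon'$ and the component $y\in\pi_0(G_{\varepsilon'})$ with $V(x)\subseteq V(y)$. Its homology is the bold homology $\mathbb{H}_*(G)$. *)

theory Defs
  imports
    "Graph_Theory.Graph_Theory"
    "Jordan_Normal_Form.Missing_VectorSpace"
    "HOL-Algebra.AbelCoset"
    "HOL-Library.Z2"
begin

text \<open>
  A finite simple graph is a symmetric digraph without loops and parallel arcs, the locale
  \<^locale>\<open>graph\<close> of \<^theory>\<open>Graph_Theory.Digraph\<close>; an undirected edge is a pair of opposite arcs.
\<close>

definition components :: "('a, 'b) pre_digraph \<Rightarrow> ('a, 'b) pre_digraph set" where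
  "components G = {H. pre_digraph.max_subgraph G connected H}"

subsection \<open>Bi-colourings and sign assignments\<close>

definition bicolourings :: "('a, 'b) pre_digraph \<Rightarrow> ('a \<Rightarrow> nat) set" where
  "bicolourings G = verts G \<rightarrow>\<^sub>E {0, 1}"

definition coloured_subgraph :: "('a, 'b) pre_digraph \<Rightarrow> ('a \<Rightarrow> nat) \<Rightarrow> ('a, 'b) pre_digraph" where
  "coloured_subgraph G \<epsilon> = G \<restriction> {v \<in> verts G. \<epsilon> v = 1}"

definition bicolouring_step :: "('a, 'b) pre_digraph \<Rightarrow> ('a \<Rightarrow> nat) \<Rightarrow> ('a \<Rightarrow> nat) \<Rightarrow> bool" where
  "bicolouring_step G \<epsilon> \<epsilon>' \<longleftrightarrow>
     \<epsilon> \<in> bicolourings G \<and> (\<exists>v\<in>verts G. \<epsilon> v = 0 \<and> \<epsilon>' = \<epsilon>(v := 1))"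

text \<open>The type \<^typ>\<open>bit\<close> is the field with two elements, so the equation below is one in $\mathbb{Z}/2$.\<close>

definition sign_assignment ::
    "('a, 'b) pre_digraph \<Rightarrow> (('a \<Rightarrow> nat) \<Rightarrow> ('a \<Rightarrow> nat) \<Rightarrow> bit) \<Rightarrow> bool" where
  "sign_assignment G s \<longleftrightarrow>
     (\<forall>\<epsilon> \<epsilon>1 \<epsilon>2 \<epsilon>''.
        bicolouring_step G \<epsilon> \<epsilon>1 \<and> bicolouring_step G \<epsilon>1 \<epsilon>'' \<and>
        bicolouring_step G \<epsilon> \<epsilon>2 \<and> bicolouring_step G \<epsilon>2 \<epsilon>'' \<and> \<epsilon>1 \<noteq> \<epsilon>2 \<longrightarrow>
        s \<epsilon> \<epsilon>1 + s \<epsilon>1 \<epsilon>'' = s \<epsilon> \<epsilon>2 + s \<epsilon>2 \<epsilon>'' + 1)"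

lemma bicolouring_stepE:
  assumes "bicolouring_step G \<epsilon> \<epsilon>'"
  obtains v where "v \<in> verts G" "\<epsilon> v = 0" "\<epsilon>' = \<epsilon>(v := 1)" "(THE v. \<epsilon> v \<noteq> \<epsilon>' v) = v"
proof -
  obtain v where v: "v \<in> verts G" "\<epsilon> v = 0" "\<epsilon>' = \<epsilon>(v := 1)"
    using assms unfolding bicolouring_step_def by blast
  have "(THE v. \<epsilon> v \<noteq> \<epsilon>' v) = v"
    by (rule the_equality) (use v in \<open>auto split: if_splits\<close>)
  with v show thesis by (rule that)
qed

lemma sign_assignment_exists:
  assumes "finite (verts G)"
  shows "\<exists>s. sign_assignment G s"
proof -
  obtain f :: "'a \<Rightarrow> nat" where f: "inj_on f (verts G)"
    using finite_imp_inj_to_nat_seg[OF assms] by blast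
  define c :: "('a \<Rightarrow> nat) \<Rightarrow> 'a \<Rightarrow> bit"
    where "c \<epsilon> v = (\<Sum>u\<in>verts G. if \<epsilon> u = 1 \<and> f u < f v then 1 else 0)" for \<epsilon> v
  define s where "s \<epsilon> \<epsilon>' = c \<epsilon> (THE v. \<epsilon> v \<noteq> \<epsilon>' v)" for \<epsilon> \<epsilon>' :: "'a \<Rightarrow> nat"
  have upd: "c (\<epsilon>(v := 1)) w = c \<epsilon> w + (if f v < f w then 1 else 0)"
    if "v \<in> verts G" "\<epsilon> v = 0" for \<epsilon> v w
  proof -
    have "c (\<epsilon>(v := 1)) w = (\<Sum>u\<in>verts G. (if \<epsilon> u = 1 \<and> f u < f w then 1 else 0) +
            (if u = v then if f v < f w then 1 else 0 else 0))"
      using that unfolding c_def by (intro sum.cong) auto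
    then show ?thesis
      using that assms unfolding sum.distrib c_def by (simp add: sum.delta)
  qed
  have "s \<epsilon> \<epsilon>1 + s \<epsilon>1 \<epsilon>'' = s \<epsilon> \<epsilon>2 + s \<epsilon>2 \<epsilon>'' + 1"
    if st: "bicolouring_step G \<epsilon> \<epsilon>1" "bicolouring_step G \<epsilon>1 \<epsilon>''"
      "bicolouring_step G \<epsilon> \<epsilon>2" "bicolouring_step G \<epsilon>2 \<epsilon>''" "\<epsilon>1 \<noteq> \<epsilon>2" for \<epsilon> \<epsilon>1 \<epsilon>2 \<epsilon>''
  proof -
    obtain v where v: "v \<in> verts G" "\<epsilon> v = 0" "\<epsilon>1 = \<epsilon>(v := 1)" "(THE v. \<epsilon> v \<noteq> \<epsilon>1 v) = v"
      using st(1) by (rule bicolouring_stepE)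
    obtain w where w: "w \<in> verts G" "\<epsilon> w = 0" "\<epsilon>2 = \<epsilon>(w := 1)" "(THE v. \<epsilon> v \<noteq> \<epsilon>2 v) = w"
      using st(3) by (rule bicolouring_stepE)
    obtain v' where v': "v' \<in> verts G" "\<epsilon>1 v' = 0" "\<epsilon>'' = \<epsilon>1(v' := 1)" "(THE v. \<epsilon>1 v \<noteq> \<epsilon>'' v) = v'"
      using st(2) by (rule bicolouring_stepE)
    obtain w' where w': "w' \<in> verts G" "\<epsilon>2 w' = 0" "\<epsilon>'' = \<epsilon>2(w' := 1)" "(THE v. \<epsilon>2 v \<noteq> \<epsilon>'' v) = w'"
      using st(4) by (rule bicolouring_stepE)
    have vw: "v \<noteq> w" using st(5) v w by auto
    have "\<epsilon>'' w = 1"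
      using w(3) w'(3) by simp
    then have v'w: "v' = w"
      using v(3) v'(3) w(2) vw by (auto split: if_splits)
    have "\<epsilon>'' v = 1"
      using v(3) v'(3) by simp
    then have w'v: "w' = v"
      using w(3) w'(3) v(2) vw by (auto split: if_splits)
    have "f v \<noteq> f w" using f v(1) w(1) vw by (auto dest: inj_onD)
    then show ?thesis
      using upd[of v \<epsilon> w] upd[of w \<epsilon> v] v w v' w' v'w w'v
      unfolding s_def by (cases "f v < f w") (auto simp: algebra_simps)
  qed
  then show ?thesis unfolding sign_assignment_def by blast
qed

subsection \<open>The bold chain complex\<close>

text \<open>
  Degrees are integers, so that the complex vanishes in negative degrees and the image of the
  differential arriving in degree 0 needs no special treatment.
\<close>

definition bold_gens ::
    "('a, 'b) pre_digraph \<Rightarrow> int \<Rightarrow> (('a \<Rightarrow> nat) \<times> ('a, 'b) pre_digraph) set" where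
  "bold_gens G i =
     {(\<epsilon>, x). \<epsilon> \<in> bicolourings G \<and> int (\<Sum>v\<in>verts G. \<epsilon> v) = i \<and>
              x \<in> components (coloured_subgraph G \<epsilon>)}"

text \<open>
  The generating set is finite, so the direct sum of copies of $K$ indexed by it is the space of
  all $K$-valued functions on it.
\<close>

definition bold_chains ::
    "('k, 'm) ring_scheme \<Rightarrow> ('a, 'b) pre_digraph \<Rightarrow> int \<Rightarrow>
     ('k, ('a \<Rightarrow> nat) \<times> ('a, 'b) pre_digraph \<Rightarrow> 'k) module" where
  "bold_chains K G i = ring.func_space K (bold_gens G i)"

definition bold_basis ::
    "('k, 'm) ring_scheme \<Rightarrow> ('a, 'b) pre_digraph \<Rightarrow> int \<Rightarrow>
     ('a \<Rightarrow> nat) \<times> ('a, 'b) pre_digraph \<Rightarrow> ('a \<Rightarrow> nat) \<times> ('a, 'b) pre_digraph \<Rightarrow> 'k" where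
  "bold_basis K G i g = (\<lambda>h\<in>bold_gens G i. if h = g then \<one>\<^bsub>K\<^esub> else \<zero>\<^bsub>K\<^esub>)"

definition sign_of :: "('k, 'm) ring_scheme \<Rightarrow> bit \<Rightarrow> 'k" where
  "sign_of K b = (if b = 0 then \<one>\<^bsub>K\<^esub> else \<ominus>\<^bsub>K\<^esub> \<one>\<^bsub>K\<^esub>)"

definition bold_diff_gen ::
    "('k, 'm) ring_scheme \<Rightarrow> ('a, 'b) pre_digraph \<Rightarrow> (('a \<Rightarrow> nat) \<Rightarrow> ('a \<Rightarrow> nat) \<Rightarrow> bit) \<Rightarrow> int \<Rightarrow>
     ('a \<Rightarrow> nat) \<times> ('a, 'b) pre_digraph \<Rightarrow> ('a \<Rightarrow> nat) \<times> ('a, 'b) pre_digraph \<Rightarrow> 'k" where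
  "bold_diff_gen K G s i = (\<lambda>(\<epsilon>, x).
     \<Oplus>\<^bsub>bold_chains K G (i + 1)\<^esub>h \<in>
         {(\<epsilon>', y). bicolouring_step G \<epsilon> \<epsilon>' \<and> y \<in> components (coloured_subgraph G \<epsilon>') \<and>
                   verts x \<subseteq> verts y}.
       sign_of K (s \<epsilon> (fst h)) \<odot>\<^bsub>bold_chains K G (i + 1)\<^esub> bold_basis K G (i + 1) h)"

definition bold_diff ::
    "('k, 'm) ring_scheme \<Rightarrow> ('a, 'b) pre_digraph \<Rightarrow> (('a \<Rightarrow> nat) \<Rightarrow> ('a \<Rightarrow> nat) \<Rightarrow> bit) \<Rightarrow> int \<Rightarrow>
     (('a \<Rightarrow> nat) \<times> ('a, 'b) pre_digraph \<Rightarrow> 'k) \<Rightarrow> ('a \<Rightarrow> nat) \<times> ('a, 'b) pre_digraph \<Rightarrow> 'k" where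
  "bold_diff K G s i c =
     (\<Oplus>\<^bsub>bold_chains K G (i + 1)\<^esub>g \<in> bold_gens G i.
        c g \<odot>\<^bsub>bold_chains K G (i + 1)\<^esub> bold_diff_gen K G s i g)"

subsection \<open>Homology\<close>

text \<open>
  The library has quotients of abelian groups and of rings, but not of modules. The ring
  multiplication that the module record inherits has no meaning here.
\<close>

definition quotient_module ::
    "('k, 'v, 'm) module_scheme \<Rightarrow> 'v set \<Rightarrow> ('k, 'v set) module" where
  "quotient_module M N =
     \<lparr>carrier = a_rcosets\<^bsub>M\<^esub> N, mult = (\<lambda>X Y. N), one = N, zero = N, add = set_add M,
      smult = (\<lambda>a X. \<Union>x\<in>X. N +>\<^bsub>M\<^esub> (a \<odot>\<^bsub>M\<^esub> x))\<rparr>"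

definition bold_homology ::
    "('k, 'm) ring_scheme \<Rightarrow> ('a, 'b) pre_digraph \<Rightarrow> (('a \<Rightarrow> nat) \<Rightarrow> ('a \<Rightarrow> nat) \<Rightarrow> bit) \<Rightarrow> int \<Rightarrow>
     ('k, (('a \<Rightarrow> nat) \<times> ('a, 'b) pre_digraph \<Rightarrow> 'k) set) module" where
  "bold_homology K G s i =
     quotient_module
       (bold_chains K G i
          \<lparr>carrier := mod_hom.ker (bold_chains K G i) (bold_chains K G (i + 1)) (bold_diff K G s i)\<rparr>)
       (mod_hom.im (bold_chains K G (i - 1)) (bold_diff K G s (i - 1)))"

end

theory Submission
  imports Defs
begin

text \<open>
  Let \<open>A\<close> and \<open>B\<close> be the parts of the complete bipartite graph. The subgraph induced by a set
  \<open>S\<close> of vertices is connected if \<open>S\<close> meets both parts, and otherwise it consists of isolated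
  vertices; such a set \<open>S\<close> is called one-sided below.

  The chains supported on the sets that meet both parts form a subcomplex, because enlarging such
  a set gives a set of the same kind. The quotient by it is a direct sum over the vertices \<open>a\<close>: the
  summand of \<open>a\<close> follows the component \<open>{a}\<close> through the one-sided sets that contain \<open>a\<close>, so it is
  the signed cube on the other vertices of the part of \<open>a\<close>. A signed cube of positive dimension is
  contractible, by the cone construction of \<open>cobd_cone_add_cone_cobd\<close>, and its dimension is positive
  since every part has a second vertex, the partner of \<open>a\<close>. Hence only the subcomplex contributes
  to the homology. This subcomplex is the tensor product of the complexes of non-empty subsets of
  \<open>A\<close> and of \<open>B\<close>. A complex of non-empty subsets is an acyclic cube without its lowest term, so
  its homology has rank one, in degree one, and the tensor product has homology of rank one, in
  degree two.

  The proof carries this out with explicit cone operators rather than with exact sequences. A chain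
  is recorded by its point parts, one cochain of the cube for every vertex \<open>a\<close>, and by its total,
  the cochain that adds up the coefficients over all components. The differential acts on both by
  the coboundary of the cube (\<open>point_part_diff\<close>, \<open>total_diff\<close>), so that the sign assignment enters
  only through the axioms of the locale \<open>signed_cube\<close>. The cone over the partner of each
  vertex removes the point parts of a cocycle. What is left lives on the sets that meet both parts,
  and there it is a coboundary as soon as its value at one chosen edge \<open>{a\<^sub>0, b\<^sub>0}\<close> is zero
  (\<open>two_sided_exact\<close>). Subtracting a multiple of one fixed cocycle of degree two makes this
  value zero (\<open>cocycle_decomposition\<close>), and that cocycle is not a boundary
  (\<open>generator_not_boundary\<close>).
\<close>

section \<open>Finite sums\<close>

lemma (in abelian_monoid) finsum_swap:
  assumes "finite A" "finite B" "\<And>x y. x \<in> A \<Longrightarrow> y \<in> B \<Longrightarrow> f x y \<in> carrier G"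
  shows "(\<Oplus>x\<in>A. \<Oplus>y\<in>B. f x y) = (\<Oplus>y\<in>B. \<Oplus>x\<in>A. f x y)"
  using assms(1,3)
proof (induction A rule: finite_induct)
  case empty
  then show ?case by simp
next
  case (insert a A)
  have "(\<Oplus>x\<in>insert a A. \<Oplus>y\<in>B. f x y) = (\<Oplus>y\<in>B. f a y) \<oplus> (\<Oplus>y\<in>B. \<Oplus>x\<in>A. f x y)"
    using insert by (subst finsum_insert) (auto simp: Pi_def)
  also have "\<dots> = (\<Oplus>y\<in>B. f a y \<oplus> (\<Oplus>x\<in>A. f x y))"
    using insert.prems by (subst finsum_addf) (auto simp: Pi_def)
  also have "\<dots> = (\<Oplus>y\<in>B. \<Oplus>x\<in>insert a A. f x y)"
    using insert by (intro finsum_cong') (auto simp: Pi_def)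
  finally show ?case .
qed

text \<open>
  Exchanging the two summations only shows that the sum is its own negative, which says nothing in
  characteristic two. The terms have to be cancelled in pairs, by induction on the index set.
\<close>

lemma (in abelian_group) finsum_skew_zero:
  assumes "finite A"
    and "\<And>v w. v \<in> A \<Longrightarrow> w \<in> A \<Longrightarrow> v \<noteq> w \<Longrightarrow> f v w \<in> carrier G"
    and "\<And>v w. v \<in> A \<Longrightarrow> w \<in> A \<Longrightarrow> v \<noteq> w \<Longrightarrow> f v w = \<ominus> f w v"
  shows "(\<Oplus>v\<in>A. \<Oplus>w\<in>A - {v}. f v w) = \<zero>"
  using assms
proof (induction A rule: finite_induct)
  case empty
  show ?case by simp
next
  case (insert a A)
  have cl: "f v w \<in> carrier G" if "v \<in> insert a A" "w \<in> insert a A" "v \<noteq> w" for v w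
    using insert.prems(1) that by blast
  have row: "(\<Oplus>w\<in>insert a A - {v}. f v w) = f v a \<oplus> (\<Oplus>w\<in>A - {v}. f v w)" if "v \<in> A" for v
  proof -
    have "insert a A - {v} = insert a (A - {v})"
      using that insert.hyps by auto
    then show ?thesis
      using that insert.hyps by (simp, subst finsum_insert) (auto intro!: finsum_closed cl)
  qed
  have "(\<Oplus>v\<in>insert a A. \<Oplus>w\<in>insert a A - {v}. f v w)
      = (\<Oplus>w\<in>insert a A - {a}. f a w) \<oplus> (\<Oplus>v\<in>A. \<Oplus>w\<in>insert a A - {v}. f v w)"
    using insert.hyps by (subst finsum_insert) (auto intro!: finsum_closed cl)
  also have "insert a A - {a} = A"
    using insert.hyps by auto
  also have "(\<Oplus>v\<in>A. \<Oplus>w\<in>insert a A - {v}. f v w) = (\<Oplus>v\<in>A. f v a \<oplus> (\<Oplus>w\<in>A - {v}. f v w))"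
    using insert.hyps row by (intro finsum_cong') (auto intro!: finsum_closed cl)
  also have "\<dots> = (\<Oplus>v\<in>A. f v a) \<oplus> (\<Oplus>v\<in>A. \<Oplus>w\<in>A - {v}. f v w)"
    using insert.hyps by (subst finsum_addf) (auto intro!: finsum_closed cl)
  also have "(\<Oplus>v\<in>A. \<Oplus>w\<in>A - {v}. f v w) = \<zero>"
    by (rule insert.IH) (rule insert.prems(1) insert.prems(2); simp)+
  also have "(\<Oplus>v\<in>A. f v a) \<oplus> \<zero> = (\<Oplus>v\<in>A. f v a)"
    using insert.hyps by (intro add.r_one finsum_closed) (auto intro!: cl)
  also have "(\<Oplus>w\<in>A. f a w) \<oplus> (\<Oplus>v\<in>A. f v a) = (\<Oplus>w\<in>A. f a w \<oplus> f w a)"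
    using insert.hyps by (subst finsum_addf) (auto intro!: finsum_closed cl)
  also have "\<dots> = (\<Oplus>w\<in>A. \<zero>)"
  proof (intro finsum_cong')
    fix w assume w: "w \<in> A"
    then have "a \<noteq> w" using insert.hyps by auto
    then show "f a w \<oplus> f w a = \<zero>"
      using insert.prems(2)[of a w] cl[of w a] w by (simp add: l_neg)
  qed auto
  also have "\<dots> = \<zero>" by simp
  finally show ?case .
qed

lemma (in ring) finsum_func_space:
  assumes "\<And>x. x \<in> A \<Longrightarrow> f x \<in> carrier (func_space S)"
  shows "finsum (func_space S) f A = (\<lambda>h\<in>S. \<Oplus>x\<in>A. f x h)"
proof -
  interpret F: abelian_monoid "func_space S"
    by (rule abelian_monoidI)
       (auto simp: func_space_def PiE_iff extensional_def restrict_def fun_eq_iff a_ac)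
  show ?thesis
    using assms
  proof (induction A rule: infinite_finite_induct)
    case (infinite A)
    then have "finsum (func_space S) f A = \<zero>\<^bsub>func_space S\<^esub>"
      by (simp add: F.finsum_infinite)
    then show ?case
      using infinite by (simp add: finsum_infinite func_space_def)
  next
    case empty
    have "finsum (func_space S) f {} = \<zero>\<^bsub>func_space S\<^esub>" by simp
    then show ?case by (simp add: func_space_def)
  next
    case (insert a A)
    have cl: "f x h \<in> carrier R" if "x \<in> insert a A" "h \<in> S" for x h
      using insert.prems[OF that(1)] that(2) by (auto simp: func_space_def)
    have "finsum (func_space S) f (insert a A)
        = f a \<oplus>\<^bsub>func_space S\<^esub> (\<lambda>h\<in>S. \<Oplus>x\<in>A. f x h)"
      using insert by (subst F.finsum_insert) (auto simp: Pi_def restrict_def)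
    also have "\<dots> = (\<lambda>h\<in>S. \<Oplus>x\<in>insert a A. f x h)"
      using insert.hyps cl
      by (auto simp: func_space_def Pi_def fun_eq_iff restrict_def finsum_insert)
    finally show ?case .
  qed
qed

section \<open>The signed cube\<close>

text \<open>
  The functions on the subsets of \<open>V\<close> with the operator \<open>cobd\<close> below form the augmented
  cochain complex of the simplex with vertex set \<open>V\<close>. The value \<open>e S v\<close> is the sign of the edge
  of the cube from \<open>S\<close> to \<open>insert v S\<close>.
\<close>

locale signed_cube = field R for R (structure) +
  fixes V :: "'v set" and e :: "'v set \<Rightarrow> 'v \<Rightarrow> 'a"
  assumes finite_V: "finite V"
    and e_closed: "e S v \<in> carrier R"
    and e_square: "e S v \<otimes> e S v = \<one>"
    and e_skew: "\<lbrakk>S \<subseteq> V; v \<in> V - S; w \<in> V - S; v \<noteq> w\<rbrakk> \<Longrightarrow>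
      e S v \<otimes> e (insert v S) w = \<ominus> (e S w \<otimes> e (insert w S) v)"
begin

declare e_closed [simp] e_square [simp]

definition cobd :: "('v set \<Rightarrow> 'a) \<Rightarrow> 'v set \<Rightarrow> 'a" where
  "cobd f S = (\<Oplus>v\<in>S. e (S - {v}) v \<otimes> f (S - {v}))"

text \<open>The simplex is a cone with apex \<open>p\<close>; this is the homotopy that contracts it to \<open>p\<close>.\<close>

definition cone :: "'v \<Rightarrow> ('v set \<Rightarrow> 'a) \<Rightarrow> 'v set \<Rightarrow> 'a" where
  "cone p f S = (if p \<in> S then \<zero> else e S p \<otimes> f (insert p S))"

lemma finite_sub: "S \<subseteq> V \<Longrightarrow> finite S"
  using finite_V finite_subset by blast

lemma e_cancel: "x \<in> carrier R \<Longrightarrow> e S v \<otimes> (e S v \<otimes> x) = x"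
  by (simp flip: m_assoc)

lemma cobd_closed: "f \<in> Pow S \<rightarrow> carrier R \<Longrightarrow> cobd f S \<in> carrier R"
  unfolding cobd_def by (intro finsum_closed) (auto simp: Pi_def)

lemma cobd_closed_Pow: "f \<in> Pow V \<rightarrow> carrier R \<Longrightarrow> cobd f \<in> Pow V \<rightarrow> carrier R"
  by (auto intro!: cobd_closed)

lemma cone_closed_Pow: "f \<in> Pow V \<rightarrow> carrier R \<Longrightarrow> p \<in> V \<Longrightarrow> cone p f \<in> Pow V \<rightarrow> carrier R"
  by (auto simp: cone_def Pi_def)

lemma cobd_cong:
  assumes "\<And>v. v \<in> S \<Longrightarrow> f (S - {v}) = g (S - {v})" "g \<in> Pow S \<rightarrow> carrier R"
  shows "cobd f S = cobd g S"
  unfolding cobd_def using assms by (intro finsum_cong') (auto simp: Pi_def)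

lemma cobd_eq_zero:
  assumes "\<And>v. v \<in> S \<Longrightarrow> f (S - {v}) = \<zero>"
  shows "cobd f S = \<zero>"
  unfolding cobd_def using assms by (intro add.finprod_one_eqI) simp

lemma cobd_add:
  assumes "f \<in> Pow S \<rightarrow> carrier R" "g \<in> Pow S \<rightarrow> carrier R"
  shows "cobd (\<lambda>T. f T \<oplus> g T) S = cobd f S \<oplus> cobd g S"
proof -
  have cl: "f (S - {v}) \<in> carrier R" "g (S - {v}) \<in> carrier R" for v
    using assms by (auto simp: Pi_def)
  show ?thesis
    unfolding cobd_def using cl
    by (simp add: r_distr Pi_def flip: finsum_addf)
qed

lemma cobd_smult:
  assumes "f \<in> Pow S \<rightarrow> carrier R" "t \<in> carrier R" "finite S"
  shows "cobd (\<lambda>T. t \<otimes> f T) S = t \<otimes> cobd f S"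
proof -
  have cl: "f (S - {v}) \<in> carrier R" for v
    using assms by (auto simp: Pi_def)
  show ?thesis
    unfolding cobd_def using cl assms
    by (simp add: finsum_rdistr Pi_def m_lcomm)
qed

lemma cobd_minus:
  assumes "f \<in> Pow S \<rightarrow> carrier R" "g \<in> Pow S \<rightarrow> carrier R" "finite S"
  shows "cobd (\<lambda>T. f T \<ominus> g T) S = cobd f S \<ominus> cobd g S"
proof -
  have cl: "\<And>T. T \<subseteq> S \<Longrightarrow> f T \<in> carrier R" "\<And>T. T \<subseteq> S \<Longrightarrow> g T \<in> carrier R"
    using assms by (auto simp: Pi_def)
  have eq: "x \<ominus> y = x \<oplus> (\<ominus> \<one>) \<otimes> y" if "x \<in> carrier R" "y \<in> carrier R" for x y
    using that by (simp add: minus_eq l_minus)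
  have "cobd (\<lambda>T. f T \<ominus> g T) S = cobd (\<lambda>T. f T \<oplus> (\<ominus> \<one>) \<otimes> g T) S"
    using cl by (intro cobd_cong) (auto simp: eq)
  also have "\<dots> = cobd f S \<oplus> cobd (\<lambda>T. (\<ominus> \<one>) \<otimes> g T) S"
    using assms cl by (intro cobd_add) auto
  also have "cobd (\<lambda>T. (\<ominus> \<one>) \<otimes> g T) S = (\<ominus> \<one>) \<otimes> cobd g S"
    using assms by (intro cobd_smult) auto
  finally show ?thesis
    using assms by (simp add: eq cobd_closed)
qed

lemma cobd_finsum:
  assumes "finite I" "finite S" "\<And>i. i \<in> I \<Longrightarrow> f i \<in> Pow S \<rightarrow> carrier R"
  shows "cobd (\<lambda>T. \<Oplus>i\<in>I. f i T) S = (\<Oplus>i\<in>I. cobd (f i) S)"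
proof -
  have cl: "f i (S - {v}) \<in> carrier R" if "i \<in> I" for i v
    using assms(3)[OF that] by (auto simp: Pi_def)
  have "cobd (\<lambda>T. \<Oplus>i\<in>I. f i T) S = (\<Oplus>v\<in>S. \<Oplus>i\<in>I. e (S - {v}) v \<otimes> f i (S - {v}))"
    unfolding cobd_def using cl assms by (intro finsum_cong') (auto simp: finsum_rdistr Pi_def)
  also have "\<dots> = (\<Oplus>i\<in>I. cobd (f i) S)"
    unfolding cobd_def using cl assms by (intro finsum_swap) auto
  finally show ?thesis .
qed

lemma e_skew_remove:
  assumes "S \<subseteq> V" "v \<in> S" "w \<in> S" "v \<noteq> w"
  shows "e (S - {v}) v \<otimes> e (S - {v} - {w}) w = \<ominus> (e (S - {w}) w \<otimes> e (S - {w} - {v}) v)"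
proof -
  have "insert w (S - {v} - {w}) = S - {v}" "insert v (S - {v} - {w}) = S - {w}"
    "S - {w} - {v} = S - {v} - {w}"
    using assms by auto
  then show ?thesis
    using e_skew[of "S - {v} - {w}" w v] assms by (auto simp: m_comm)
qed

lemma cobd_cobd:
  assumes "S \<subseteq> V" "f \<in> Pow S \<rightarrow> carrier R"
  shows "cobd (cobd f) S = \<zero>"
proof -
  have cl: "f (S - {v} - {w}) \<in> carrier R" for v w
    using assms by blast
  have "cobd (cobd f) S
      = (\<Oplus>v\<in>S. \<Oplus>w\<in>S - {v}. e (S - {v}) v \<otimes> e (S - {v} - {w}) w \<otimes> f (S - {v} - {w}))"
    unfolding cobd_def using cl finite_sub[OF assms(1)]
    by (intro finsum_cong') (auto simp: finsum_rdistr Pi_def m_assoc)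
  also have "\<dots> = \<zero>"
  proof (rule finsum_skew_zero)
    fix v w assume vw: "v \<in> S" "w \<in> S" "v \<noteq> w"
    have "S - {w} - {v} = S - {v} - {w}" by auto
    then show "e (S - {v}) v \<otimes> e (S - {v} - {w}) w \<otimes> f (S - {v} - {w})
        = \<ominus> (e (S - {w}) w \<otimes> e (S - {w} - {v}) v \<otimes> f (S - {w} - {v}))"
      using e_skew_remove[OF assms(1) vw] cl by (simp add: l_minus)
  qed (use cl finite_sub[OF assms(1)] in auto)
  finally show ?thesis .
qed

lemma cobd_cone_add_cone_cobd:
  assumes "S \<subseteq> V" "p \<in> V" "f \<in> Pow V \<rightarrow> carrier R"
  shows "cobd (cone p f) S \<oplus> cone p (cobd f) S = f S"
proof -
  have cl: "f T \<in> carrier R" if "T \<subseteq> V" for T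
    using that assms(3) by auto
  have fin: "finite S" using finite_sub[OF assms(1)] .
  show ?thesis
  proof (cases "p \<in> S")
    case True
    have "insert p (S - {p}) = S" using True by auto
    then have "cobd (cone p f) S = (\<Oplus>v\<in>S. if v = p then f S else \<zero>)"
      unfolding cobd_def using assms(1) cl
      by (intro finsum_cong') (auto simp: cone_def e_cancel True)
    also have "\<dots> = f S"
      using True fin cl assms(1) by (simp add: add.finprod_singleton_swap)
    finally show ?thesis
      using True cl assms(1) by (simp add: cone_def)
  next
    case False
    \<comment> \<open>Both operators produce the sum \<open>X\<close> over the vertices of \<open>S\<close>, and the skewness of the
      signs gives it opposite signs. The edge from \<open>S\<close> to the apex leaves the term \<open>f S\<close>.\<close>
    define X where "X = (\<Oplus>v\<in>S. e (S - {v}) v \<otimes> (e (S - {v}) p \<otimes> f (insert p (S - {v}))))"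
    have sub: "insert p (S - {v}) \<subseteq> V" "insert p S - {v} \<subseteq> V" for v using assms by auto
    have X: "X \<in> carrier R"
      unfolding X_def using cl sub by (intro finsum_closed) auto
    have 1: "cobd (cone p f) S = X"
      unfolding cobd_def X_def using False cl sub by (intro finsum_cong') (auto simp: cone_def)
    have "cobd f (insert p S) = e S p \<otimes> f S \<oplus>
        (\<Oplus>v\<in>S. e (insert p S - {v}) v \<otimes> f (insert p S - {v}))"
      unfolding cobd_def using False fin cl assms sub
      by (subst finsum_insert) (auto simp: Pi_def)
    also have "(\<Oplus>v\<in>S. e (insert p S - {v}) v \<otimes> f (insert p S - {v}))
       = (\<Oplus>v\<in>S. \<ominus> e S p \<otimes> (e (S - {v}) v \<otimes> (e (S - {v}) p \<otimes> f (insert p (S - {v})))))"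
    proof (intro finsum_cong')
      fix v assume v: "v \<in> S"
      then have eq: "insert p S - {v} = insert p (S - {v})" "insert v (S - {v}) = S"
        using False by auto
      have "e (S - {v}) p \<otimes> e (insert p (S - {v})) v = \<ominus> (e (S - {v}) v \<otimes> e S p)"
        using e_skew[of "S - {v}" p v] v assms False eq by auto
      then have "e (S - {v}) p \<otimes> (e (S - {v}) p \<otimes> e (insert p (S - {v})) v)
          = e (S - {v}) p \<otimes> \<ominus> (e (S - {v}) v \<otimes> e S p)" by simp
      then have "e (insert p (S - {v})) v = \<ominus> (e (S - {v}) p \<otimes> (e (S - {v}) v \<otimes> e S p))"
        by (simp add: e_cancel r_minus)
      then show "e (insert p S - {v}) v \<otimes> f (insert p S - {v}) =
         \<ominus> e S p \<otimes> (e (S - {v}) v \<otimes> (e (S - {v}) p \<otimes> f (insert p (S - {v}))))"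
        using cl[OF sub(1)[of v]] unfolding eq by (simp add: l_minus r_minus m_ac del: e_square)
    qed (use cl sub in auto)
    also have "\<dots> = \<ominus> e S p \<otimes> X"
      unfolding X_def using fin cl sub by (subst finsum_rdistr) auto
    finally have "cone p (cobd f) S = f S \<ominus> X"
      using False cl assms X by (simp add: cone_def r_distr l_minus r_minus e_cancel minus_eq)
    then show ?thesis
      using 1 X cl[OF assms(1)] by (simp add: minus_eq a_lcomm[of X "f S"] r_neg)
  qed
qed

text \<open>A cochain that is closed on the cone over \<open>S\<close> is therefore exact at \<open>S\<close>.\<close>

lemma cobd_cone:
  assumes "S \<subseteq> V" "p \<in> V" "f \<in> Pow V \<rightarrow> carrier R"
    and "p \<notin> S \<Longrightarrow> cobd f (insert p S) = \<zero>"
  shows "cobd (cone p f) S = f S"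
proof -
  have "cone p (cobd f) S = \<zero>"
    using assms(4) by (auto simp: cone_def)
  then show ?thesis
    using cobd_cone_add_cone_cobd[OF assms(1-3)]
      cobd_closed[of "cone p f" S] cone_closed_Pow[OF assms(3,2)] assms(1) by (auto simp: Pi_def)
qed

end

section \<open>Quotient modules\<close>

lemma (in module) submodule_imp_subgroup:
  assumes "submodule R N M"
  shows "subgroup N (add_monoid M)"
proof (rule add.subgroupI)
  fix a assume a: "a \<in> N"
  then have "(\<ominus> \<one>) \<odot>\<^bsub>M\<^esub> a \<in> N" "a \<in> carrier M"
    using assms by (auto simp: submodule_def)
  then show "\<ominus>\<^bsub>M\<^esub> a \<in> N"
    by (simp add: smult_minus_1)
qed (use assms in \<open>auto simp: submodule_def\<close>)

text \<open>
  A scalar multiple in the quotient is a union over all representatives; it is a single coset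
  because multiples of representatives of the same coset differ by an element of \<open>N\<close>.
\<close>

lemma (in module) quotient_smult_coset:
  assumes N: "submodule R N M" and "a \<in> carrier R" "y \<in> carrier M"
  shows "(\<Union>x\<in>N +>\<^bsub>M\<^esub> y. N +>\<^bsub>M\<^esub> (a \<odot>\<^bsub>M\<^esub> x)) = N +>\<^bsub>M\<^esub> (a \<odot>\<^bsub>M\<^esub> y)"
proof -
  have sub: "N \<subseteq> carrier M" and sm: "\<And>x. x \<in> N \<Longrightarrow> a \<odot>\<^bsub>M\<^esub> x \<in> N" and zero: "\<zero>\<^bsub>M\<^esub> \<in> N"
    using N assms(2) by (auto simp: submodule_def)
  have sg: "subgroup N (add_monoid M)"
    using N by (rule submodule_imp_subgroup)
  have "N +>\<^bsub>M\<^esub> (a \<odot>\<^bsub>M\<^esub> x) = N +>\<^bsub>M\<^esub> (a \<odot>\<^bsub>M\<^esub> y)" if x: "x \<in> N +>\<^bsub>M\<^esub> y" for x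
  proof -
    obtain n where n: "n \<in> N" "x = n \<oplus>\<^bsub>M\<^esub> y"
      using x unfolding a_r_coset_def' by auto
    then have "a \<odot>\<^bsub>M\<^esub> x = a \<odot>\<^bsub>M\<^esub> n \<oplus>\<^bsub>M\<^esub> a \<odot>\<^bsub>M\<^esub> y"
      using assms sub by (auto simp: smult_r_distr)
    then have "a \<odot>\<^bsub>M\<^esub> x \<in> N +>\<^bsub>M\<^esub> (a \<odot>\<^bsub>M\<^esub> y)"
      using n sm unfolding a_r_coset_def' by auto
    then show ?thesis
      using M.a_repr_independence[OF _ _ sg, of "a \<odot>\<^bsub>M\<^esub> x" "a \<odot>\<^bsub>M\<^esub> y"] assms by auto
  qed
  moreover have "y \<in> N +>\<^bsub>M\<^esub> y"
    using zero assms(3) unfolding a_r_coset_def' by force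
  ultimately show ?thesis by blast
qed

text \<open>
  The projection to cosets is onto and respects addition and scalar multiplication, so the module
  axioms pass from \<open>M\<close> to the quotient.
\<close>

lemma (in module) quotient_module_is_module:
  assumes N: "submodule R N M"
  shows "module R (quotient_module M N)"
proof -
  let ?Q = "quotient_module M N" and ?q = "\<lambda>x. N +>\<^bsub>M\<^esub> x"
  have sg: "subgroup N (add_monoid M)"
    using N by (rule submodule_imp_subgroup)
  interpret N: abelian_subgroup N M
    by (intro abelian_subgroupI3 additive_subgroup.intro sg M.abelian_group_axioms)
  have car: "carrier ?Q = ?q ` carrier M"
    by (auto simp: quotient_module_def A_RCOSETS_def')
  have add: "?q x \<oplus>\<^bsub>?Q\<^esub> ?q y = ?q (x \<oplus>\<^bsub>M\<^esub> y)" if "x \<in> carrier M" "y \<in> carrier M" for x y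
    using that by (simp add: quotient_module_def N.a_rcos_sum)
  have smult: "a \<odot>\<^bsub>?Q\<^esub> ?q x = ?q (a \<odot>\<^bsub>M\<^esub> x)" if "a \<in> carrier R" "x \<in> carrier M" for a x
    using that quotient_smult_coset[OF N] by (simp add: quotient_module_def)
  have zero: "\<zero>\<^bsub>?Q\<^esub> = ?q \<zero>\<^bsub>M\<^esub>"
    using N.a_subset by (simp add: quotient_module_def)
  have "abelian_group ?Q"
  proof (rule abelian_groupI)
    fix X assume "X \<in> carrier ?Q"
    then obtain x where x: "x \<in> carrier M" "X = ?q x" using car by auto
    then show "\<exists>Y\<in>carrier ?Q. Y \<oplus>\<^bsub>?Q\<^esub> X = \<zero>\<^bsub>?Q\<^esub>"
      by (intro bexI[of _ "?q (\<ominus>\<^bsub>M\<^esub> x)"]) (auto simp: add zero car M.l_neg)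
  qed (auto simp: car add zero M.a_ac)
  then show ?thesis
    by (intro moduleI R.is_cring)
      (auto simp: car add smult smult_l_distr smult_r_distr smult_assoc1)
qed

lemma (in vectorspace) dim_one_if_cyclic:
  assumes "z \<in> carrier V" "z \<noteq> \<zero>\<^bsub>V\<^esub>" "\<And>x. x \<in> carrier V \<Longrightarrow> \<exists>t\<in>carrier K. x = t \<odot>\<^bsub>V\<^esub> z"
  shows "fin_dim" and "dim = 1"
proof -
  have "x \<in> span {z}" if x: "x \<in> carrier V" for x
  proof -
    obtain t where t: "t \<in> carrier K" "x = t \<odot>\<^bsub>V\<^esub> z" using assms(3)[OF x] by blast
    have "submodule K (span {z}) V" "z \<in> span {z}"
      using assms(1) by (auto intro!: span_is_submodule in_own_span[THEN subsetD])
    then show ?thesis using t by (auto simp: submodule_def)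
  qed
  then have gen: "span {z} = carrier V"
    using assms(1) span_is_subset2[of "{z}"] by auto
  then show "fin_dim"
    using assms(1) unfolding fin_dim_def by (intro exI[of _ "{z}"]) auto
  show "dim = 1"
    using gen assms by (intro dim1I) auto
qed

subsection \<open>Homology at one place of a complex\<close>

locale module_complex = f: mod_hom R L M f + g: mod_hom R M N g
  for R (structure) and L M N f g +
  assumes comp_zero: "x \<in> carrier L \<Longrightarrow> g (f x) = \<zero>\<^bsub>N\<^esub>"
begin

definition homology where
  "homology = quotient_module (M\<lparr>carrier := mod_hom.ker M N g\<rparr>) (mod_hom.im L f)"

lemma im_submodule_ker: "submodule R (mod_hom.im L f) (M\<lparr>carrier := mod_hom.ker M N g\<rparr>)"
  using f.im_is_submodule f.N.submodule_is_module[OF g.ker_is_submodule] comp_zero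
  by (auto simp: submodule_def g.ker_def f.im_def)

lemma homology_module: "module R homology"
  unfolding homology_def
  using f.N.submodule_is_module[OF g.ker_is_submodule]
  by (intro module.quotient_module_is_module im_submodule_ker)

lemma homology_trivial:
  assumes "\<And>c. c \<in> carrier M \<Longrightarrow> g c = \<zero>\<^bsub>N\<^esub> \<Longrightarrow> c \<in> f ` carrier L"
  shows "carrier homology = {\<zero>\<^bsub>homology\<^esub>}"
proof -
  interpret H: module R homology by (rule homology_module)
  interpret Z: module R "M\<lparr>carrier := mod_hom.ker M N g\<rparr>"
    using f.N.submodule_is_module[OF g.ker_is_submodule] .
  have sg: "subgroup (mod_hom.im L f) (add_monoid (M\<lparr>carrier := mod_hom.ker M N g\<rparr>))"
    by (rule Z.submodule_imp_subgroup[OF im_submodule_ker])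
  have "X = mod_hom.im L f" if X: "X \<in> carrier homology" for X
  proof -
    obtain c where "c \<in> g.ker" "X = f.im +>\<^bsub>M\<lparr>carrier := g.ker\<rparr>\<^esub> c"
      using X by (auto simp: homology_def quotient_module_def A_RCOSETS_def')
    then show ?thesis
      using assms Z.M.a_coset_join2[OF _ sg] by (auto simp: g.ker_def f.im_def)
  qed
  then show ?thesis
    using H.M.zero_closed by (auto simp: homology_def quotient_module_def)
qed

lemma homology_one_dimensional:
  assumes K: "field R"
    and z: "z \<in> carrier M" "g z = \<zero>\<^bsub>N\<^esub>" "z \<notin> f ` carrier L"
    and span: "\<And>c. c \<in> carrier M \<Longrightarrow> g c = \<zero>\<^bsub>N\<^esub> \<Longrightarrow>
      \<exists>b\<in>carrier L. \<exists>t\<in>carrier R. c = f b \<oplus>\<^bsub>M\<^esub> t \<odot>\<^bsub>M\<^esub> z"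
  shows "vectorspace R homology" and "vectorspace.fin_dim R homology"
    and "vectorspace.dim R homology = 1"
proof -
  let ?Z = "M\<lparr>carrier := mod_hom.ker M N g\<rparr>" and ?B = "mod_hom.im L f"
  interpret F: field R by (rule K)
  interpret H: vectorspace R homology
    using homology_module K by (intro vectorspace.intro)
  interpret Z: module R ?Z
    using f.N.submodule_is_module[OF g.ker_is_submodule] .
  have sg: "subgroup ?B (add_monoid ?Z)"
    by (rule Z.submodule_imp_subgroup[OF im_submodule_ker])
  interpret B: abelian_subgroup ?B ?Z
    by (intro abelian_subgroupI3 additive_subgroup.intro sg Z.M.abelian_group_axioms)
  let ?q = "\<lambda>x. ?B +>\<^bsub>?Z\<^esub> x"
  have car: "carrier homology = ?q ` g.ker"
    by (auto simp: homology_def quotient_module_def A_RCOSETS_def')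
  have zero: "\<zero>\<^bsub>homology\<^esub> = ?B"
    by (simp add: homology_def quotient_module_def)
  have zker: "z \<in> g.ker" using z by (simp add: g.ker_def)
  have cyc: "\<exists>t\<in>carrier R. X = t \<odot>\<^bsub>homology\<^esub> ?q z" if X: "X \<in> carrier homology" for X
  proof -
    obtain c where c: "c \<in> g.ker" "X = ?q c" using X car by auto
    then have "c \<in> carrier M" "g c = \<zero>\<^bsub>N\<^esub>"
      by (auto simp: g.ker_def)
    then obtain b t where bt: "b \<in> carrier L" "t \<in> carrier R" "c = f b \<oplus>\<^bsub>M\<^esub> t \<odot>\<^bsub>M\<^esub> z"
      using span[of c] by blast
    have tz: "t \<odot>\<^bsub>M\<^esub> z \<in> g.ker" using Z.smult_closed[of t z] bt zker by simp
    have "c \<in> ?q (t \<odot>\<^bsub>M\<^esub> z)"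
      using bt unfolding a_r_coset_def' by (auto simp: f.im_def)
    then have "?q (t \<odot>\<^bsub>M\<^esub> z) = X"
      using Z.M.a_repr_independence[OF _ _ sg] tz c by simp
    moreover have "t \<odot>\<^bsub>homology\<^esub> ?q z = ?q (t \<odot>\<^bsub>M\<^esub> z)"
      using Z.quotient_smult_coset[OF im_submodule_ker bt(2), of z] zker
      by (simp add: homology_def quotient_module_def)
    ultimately show ?thesis using bt by auto
  qed
  have nz: "?q z \<noteq> \<zero>\<^bsub>homology\<^esub>"
    using Z.M.a_coset_join1[OF _ _ sg, of z] z zker by (auto simp: zero f.im_def)
  have mem: "?q z \<in> carrier homology" using zker car by auto
  show "vectorspace R homology" ..
  show "vectorspace.fin_dim R homology" "vectorspace.dim R homology = 1"
    using H.dim_one_if_cyclic[OF mem nz cyc] by auto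
qed

end

section \<open>Cochains relative to a bipartition\<close>

text \<open>
  The partner of a vertex is another vertex on the same side. It is the apex of the cone
  that contracts the cube of the one-sided sets containing the vertex.
\<close>

locale bipartite_cube = signed_cube R V e
  for R (structure) and V :: "'v set" and e +
  fixes A B :: "'v set" and a\<^sub>0 b\<^sub>0 :: 'v and partner :: "'v \<Rightarrow> 'v"
  assumes V_eq: "V = A \<union> B" and disjoint: "A \<inter> B = {}"
    and a0: "a\<^sub>0 \<in> A" and b0: "b\<^sub>0 \<in> B"
    and partner_A: "a \<in> A \<Longrightarrow> partner a \<in> A - {a}"
    and partner_B: "b \<in> B \<Longrightarrow> partner b \<in> B - {b}"
begin

definition one_sided :: "'v set \<Rightarrow> bool" where
  "one_sided S \<longleftrightarrow> S \<subseteq> A \<or> S \<subseteq> B"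

definition graded :: "int \<Rightarrow> ('v set \<Rightarrow> 'a) \<Rightarrow> bool" where
  "graded i f \<longleftrightarrow> (\<forall>S\<subseteq>V. int (card S) \<noteq> i \<longrightarrow> f S = \<zero>)"

lemma one_sided_subset: "one_sided S \<Longrightarrow> T \<subseteq> S \<Longrightarrow> one_sided T"
  by (auto simp: one_sided_def)

lemma one_sided_sub_V: "one_sided S \<Longrightarrow> S \<subseteq> V"
  by (auto simp: one_sided_def V_eq)

lemma a0_V: "a\<^sub>0 \<in> V" and b0_V: "b\<^sub>0 \<in> V" and a0_b0: "a\<^sub>0 \<noteq> b\<^sub>0"
  using a0 b0 disjoint by (auto simp: V_eq)

lemma partner_V: "v \<in> V \<Longrightarrow> partner v \<in> V" and partner_neq: "v \<in> V \<Longrightarrow> partner v \<noteq> v"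
  using partner_A partner_B by (auto simp: V_eq)

lemma one_sided_insert_partner: "one_sided S \<Longrightarrow> v \<in> S \<Longrightarrow> one_sided (insert (partner v) S)"
  using partner_A partner_B by (auto simp: one_sided_def)

lemma graded_cone:
  assumes "graded i f" "p \<in> V"
  shows "graded (i - 1) (cone p f)"
  unfolding graded_def
proof (intro allI impI)
  fix S assume S: "S \<subseteq> V" "int (card S) \<noteq> i - 1"
  show "cone p f S = \<zero>"
  proof (cases "p \<in> S")
    case False
    then have "int (card (insert p S)) \<noteq> i"
      using S finite_sub by auto
    then show ?thesis
      using assms S False by (auto simp: cone_def graded_def)
  qed (simp add: cone_def)
qed

lemma graded_cobd:
  assumes "graded i f"
  shows "graded (i + 1) (cobd f)"
  unfolding graded_def
proof (intro allI impI cobd_eq_zero)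
  fix S v assume S: "S \<subseteq> V" "int (card S) \<noteq> i + 1" "v \<in> S"
  then have "card S = Suc (card (S - {v}))"
    using finite_sub by (metis card.remove)
  then have "int (card (S - {v})) \<noteq> i"
    using S(2) by linarith
  then show "f (S - {v}) = \<zero>"
    using assms S(1) unfolding graded_def by blast
qed

subsection \<open>The cocycle in degree two\<close>

definition vertex_cochain :: "'v set \<Rightarrow> 'a" where
  "vertex_cochain S = (if \<exists>a\<in>A. S = {a} then e {} (THE a. S = {a}) else \<zero>)"

lemma vertex_cochain_closed: "vertex_cochain S \<in> carrier R"
  by (simp add: vertex_cochain_def)

lemma graded_vertex_cochain: "graded 1 vertex_cochain"
  by (auto simp: graded_def vertex_cochain_def)

text \<open>
  On subsets of \<open>A\<close> the vertex cochain is the coboundary of the augmentation, the indicator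
  function of the empty set, and on subsets of \<open>B\<close> it is zero.
\<close>

lemma cobd_vertex_cochain_one_sided:
  assumes "one_sided S"
  shows "cobd vertex_cochain S = \<zero>"
proof (cases "S \<subseteq> A")
  case True
  define aug where "aug T = (if T = {} then \<one> else \<zero>)" for T :: "'v set"
  have "vertex_cochain T = cobd aug T" if T: "T \<subseteq> A" for T
  proof (cases "\<exists>a\<in>A. T = {a}")
    case True
    then obtain a where "T = {a}" by blast
    then show ?thesis
      using T by (simp add: vertex_cochain_def cobd_def aug_def)
  next
    case False
    then have "cobd aug T = \<zero>"
      using T by (intro cobd_eq_zero) (auto simp: aug_def)
    then show ?thesis
      using False by (simp add: vertex_cochain_def)
  qed
  then have "cobd vertex_cochain S = cobd (cobd aug) S"
    using True by (intro cobd_cong) (blast, auto intro!: cobd_closed simp: aug_def)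
  also have "\<dots> = \<zero>"
    using True by (intro cobd_cobd) (auto simp: V_eq aug_def)
  finally show ?thesis .
next
  case False
  then show ?thesis
    using assms disjoint by (intro cobd_eq_zero) (auto simp: one_sided_def vertex_cochain_def)
qed

lemma cobd_pair:
  assumes "a \<noteq> b" "f {a} \<in> carrier R" "f {b} \<in> carrier R"
  shows "cobd f {a, b} = e {b} a \<otimes> f {b} \<oplus> e {a} b \<otimes> f {a}"
proof -
  have "{a, b} - {a} = {b}" "{a, b} - {b} = {a}" using assms by auto
  then show ?thesis
    using assms by (simp add: cobd_def finsum_insert Pi_def)
qed

lemma cobd_vertex_cochain_a0_b0:
  "cobd vertex_cochain {a\<^sub>0, b\<^sub>0} = e {a\<^sub>0} b\<^sub>0 \<otimes> e {} a\<^sub>0"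
  using a0 b0 disjoint a0_b0
  by (subst cobd_pair) (auto simp: vertex_cochain_def)

lemma cobd_vertex_cochain_square:
  "cobd vertex_cochain {a\<^sub>0, b\<^sub>0} \<otimes> cobd vertex_cochain {a\<^sub>0, b\<^sub>0} = \<one>"
proof -
  have "(x \<otimes> y) \<otimes> (x \<otimes> y) = (x \<otimes> x) \<otimes> (y \<otimes> y)" if "x \<in> carrier R" "y \<in> carrier R" for x y
    using that by (simp add: m_ac)
  from this[of "e {a\<^sub>0} b\<^sub>0" "e {} a\<^sub>0"] show ?thesis
    by (simp add: cobd_vertex_cochain_a0_b0)
qed

subsection \<open>Cochains that vanish on one-sided sets\<close>

text \<open>
  Among the one-sided sets, the primitive \<open>cone a\<^sub>0 c\<close> can be non-zero only at subsets of \<open>B\<close>. Its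
  restriction to them is closed there, so it is the coboundary of the cone over it with apex \<open>b\<^sub>0\<close>, and
  subtracting this coboundary corrects the primitive. The hypothesis on the pair is
  what makes the correction vanish on the subsets of \<open>A\<close>.
\<close>

lemma two_sided_exact:
  assumes c: "c \<in> Pow V \<rightarrow> carrier R"
    and one_sided: "\<And>S. one_sided S \<Longrightarrow> c S = \<zero>"
    and closed: "\<And>S. S \<subseteq> V \<Longrightarrow> cobd c S = \<zero>"
    and pair: "c {a\<^sub>0, b\<^sub>0} = \<zero>"
    and deg: "graded i c"
  obtains m where "m \<in> Pow V \<rightarrow> carrier R" "graded (i - 1) m"
    "\<And>S. one_sided S \<Longrightarrow> m S = \<zero>" "\<And>S. S \<subseteq> V \<Longrightarrow> cobd m S = c S"
proof -
  define h where "h = cone a\<^sub>0 c"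
  define g where "g S = (if S \<subseteq> B then h S else \<zero>)" for S
  define k where "k = cone b\<^sub>0 g"
  define m where "m S = h S \<ominus> cobd k S" for S
  have hc: "h \<in> Pow V \<rightarrow> carrier R"
    unfolding h_def using c a0_V by (rule cone_closed_Pow)
  have gc: "g \<in> Pow V \<rightarrow> carrier R"
    using hc by (auto simp: g_def)
  have kc: "k \<in> Pow V \<rightarrow> carrier R"
    unfolding k_def using gc b0_V by (rule cone_closed_Pow)
  have dkc: "cobd k \<in> Pow V \<rightarrow> carrier R"
    using kc by (rule cobd_closed_Pow)
  have mc: "m \<in> Pow V \<rightarrow> carrier R"
    using hc dkc by (auto simp: m_def Pi_def)
  have dh: "cobd h S = c S" if "S \<subseteq> V" for S
    unfolding h_def using that c a0_V closed by (intro cobd_cone) auto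
  have "graded (i - 1) h"
    unfolding h_def using deg a0_V by (rule graded_cone)
  moreover from this have "graded (i - 1) g"
    by (auto simp: g_def graded_def)
  then have "graded (i - 1 - 1 + 1) (cobd k)"
    unfolding k_def using b0_V by (intro graded_cobd graded_cone)
  ultimately have grm: "graded (i - 1) m"
    by (auto simp: graded_def m_def)
  have dg: "cobd g S = \<zero>" if "S \<subseteq> B" for S
  proof -
    have "cobd g S = cobd h S"
      using that hc by (intro cobd_cong) (auto simp: g_def V_eq Pi_def)
    also have "\<dots> = \<zero>"
      using that dh[of S] one_sided[of S] by (auto simp: V_eq one_sided_def)
    finally show ?thesis .
  qed
  have m0: "m S = \<zero>" if S: "one_sided S" for S
  proof (cases "S \<subseteq> B")
    case True
    have "cobd k S = g S"
      unfolding k_def using True gc b0 b0_V dg[of "insert b\<^sub>0 S"]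
      by (intro cobd_cone) (auto simp: V_eq)
    moreover have "h S \<in> carrier R"
      using hc True by (auto simp: V_eq)
    ultimately show ?thesis
      using True by (simp add: m_def g_def r_neg minus_eq)
  next
    case False
    then have SA: "S \<subseteq> A" using S by (auto simp: one_sided_def)
    have "h S = \<zero>"
      using SA a0 one_sided[of "insert a\<^sub>0 S"] by (auto simp: h_def cone_def one_sided_def)
    have k0: "k T = \<zero>" if T: "T \<subseteq> A" for T
    proof (cases "T = {}")
      case True
      have "h {b\<^sub>0} = \<zero>"
        using pair a0_b0 by (simp add: h_def cone_def)
      then show ?thesis
        using True b0 by (simp add: k_def cone_def g_def)
    next
      case False
      then have "\<not> insert b\<^sub>0 T \<subseteq> B" using T disjoint by auto
      then have "g (insert b\<^sub>0 T) = \<zero>"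
        by (simp only: g_def if_False)
      then show ?thesis
        by (simp add: k_def cone_def)
    qed
    have "cobd k S = \<zero>"
      using SA by (intro cobd_eq_zero k0) blast
    with \<open>h S = \<zero>\<close> show ?thesis by (simp add: m_def minus_eq)
  qed
  have "cobd m S = c S" if S: "S \<subseteq> V" for S
  proof -
    have "cobd m S = cobd h S \<ominus> cobd (cobd k) S"
      unfolding m_def using S hc dkc finite_sub by (intro cobd_minus) (auto simp: Pi_def)
    also have "cobd (cobd k) S = \<zero>"
      using S kc by (intro cobd_cobd) (auto simp: Pi_def)
    finally show ?thesis
      using S dh c by (simp add: minus_eq Pi_def)
  qed
  with mc grm m0 show thesis by (rule that)
qed

text \<open>
  The functions \<open>\<phi>\<close> and \<open>\<tau>\<close> stand for the point parts and the total of a cocycle. The cones over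
  the partners are primitives of the point parts, and subtracting the coboundary of their
  sum from \<open>\<tau>\<close> leaves a closed cochain that vanishes on one-sided sets. A multiple of the
  coboundary of the vertex cochain corrects its value at \<open>{a\<^sub>0, b\<^sub>0}\<close>, after which
  \<open>two_sided_exact\<close> applies.
\<close>

lemma cocycle_decomposition:
  assumes phi: "\<And>a. a \<in> V \<Longrightarrow> \<phi> a \<in> Pow V \<rightarrow> carrier R"
    and tau: "\<tau> \<in> Pow V \<rightarrow> carrier R"
    and supp: "\<And>a S. \<lbrakk>a \<in> V; S \<subseteq> V; \<not> (one_sided S \<and> a \<in> S)\<rbrakk> \<Longrightarrow> \<phi> a S = \<zero>"
    and tau_one_sided: "\<And>S. one_sided S \<Longrightarrow> \<tau> S = (\<Oplus>a\<in>V. \<phi> a S)"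
    and phi_closed: "\<And>a S. \<lbrakk>a \<in> V; one_sided S\<rbrakk> \<Longrightarrow> cobd (\<phi> a) S = \<zero>"
    and tau_closed: "\<And>S. S \<subseteq> V \<Longrightarrow> cobd \<tau> S = \<zero>"
    and deg: "\<And>a. a \<in> V \<Longrightarrow> graded i (\<phi> a)" "graded i \<tau>"
  obtains \<psi> m t where "\<And>a. a \<in> V \<Longrightarrow> \<psi> a \<in> Pow V \<rightarrow> carrier R"
    and "\<And>a S. \<lbrakk>a \<in> V; S \<subseteq> V; \<not> (one_sided S \<and> a \<in> S)\<rbrakk> \<Longrightarrow> \<psi> a S = \<zero>"
    and "\<And>a. a \<in> V \<Longrightarrow> graded (i - 1) (\<psi> a)"
    and "\<And>a S. \<lbrakk>a \<in> V; one_sided S\<rbrakk> \<Longrightarrow> cobd (\<psi> a) S = \<phi> a S"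
    and "m \<in> Pow V \<rightarrow> carrier R" and "graded (i - 1) m"
    and "\<And>S. one_sided S \<Longrightarrow> m S = \<zero>"
    and "t \<in> carrier R" and "i \<noteq> 2 \<Longrightarrow> t = \<zero>"
    and "\<And>S. S \<subseteq> V \<Longrightarrow>
      \<tau> S = cobd (\<lambda>T. m T \<oplus> (\<Oplus>a\<in>V. \<psi> a T)) S \<oplus> t \<otimes> cobd vertex_cochain S"
proof -
  define \<psi> where "\<psi> a = cone (partner a) (\<phi> a)" for a
  define \<sigma> where "\<sigma> T = (\<Oplus>a\<in>V. \<psi> a T)" for T
  define r where "r S = \<tau> S \<ominus> cobd \<sigma> S" for S
  define z where "z = cobd vertex_cochain"
  \<comment> \<open>The value of \<open>z\<close> at the pair is its own inverse, so \<open>t\<close> is the quotient of the two values.\<close>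
  define t where "t = r {a\<^sub>0, b\<^sub>0} \<otimes> z {a\<^sub>0, b\<^sub>0}"
  define c where "c S = r S \<ominus> t \<otimes> z S" for S
  have psi: "\<psi> a \<in> Pow V \<rightarrow> carrier R" if "a \<in> V" for a
    unfolding \<psi>_def using phi partner_V that by (intro cone_closed_Pow)
  have psi_supp: "\<psi> a S = \<zero>" if a: "a \<in> V" and S: "S \<subseteq> V" and n: "\<not> (one_sided S \<and> a \<in> S)" for a S
  proof -
    have "\<not> (one_sided (insert (partner a) S) \<and> a \<in> insert (partner a) S)"
      using n one_sided_subset[of "insert (partner a) S" S] partner_neq[OF a] by auto
    then show ?thesis
      using supp[OF a, of "insert (partner a) S"] a S partner_V[OF a]
      by (auto simp: \<psi>_def cone_def)
  qed
  have psi_deg: "graded (i - 1) (\<psi> a)" if "a \<in> V" for a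
    unfolding \<psi>_def using deg(1) partner_V that by (intro graded_cone)
  have psi_cobd: "cobd (\<psi> a) S = \<phi> a S" if a: "a \<in> V" and S: "one_sided S" for a S
  proof (cases "a \<in> S")
    case True
    then show ?thesis
      unfolding \<psi>_def using a S phi_closed one_sided_insert_partner
      by (intro cobd_cone phi partner_V one_sided_sub_V) auto
  next
    case False
    then have "cobd (\<psi> a) S = \<zero>"
      using a one_sided_sub_V[OF S] by (intro cobd_eq_zero psi_supp) auto
    then show ?thesis
      using False a one_sided_sub_V[OF S] supp by auto
  qed
  have sg: "\<sigma> \<in> Pow V \<rightarrow> carrier R"
    using psi by (auto simp: \<sigma>_def Pi_def)
  have dsg: "cobd \<sigma> \<in> Pow V \<rightarrow> carrier R"
    using sg by (rule cobd_closed_Pow)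
  have sg_deg: "graded (i - 1) \<sigma>"
    using psi_deg by (auto simp: graded_def \<sigma>_def intro!: add.finprod_one_eqI)
  have dsg_deg: "graded i (cobd \<sigma>)"
    using graded_cobd[OF sg_deg] by simp
  have sg_one_sided: "cobd \<sigma> S = \<tau> S" if S: "one_sided S" for S
  proof -
    have "cobd \<sigma> S = (\<Oplus>a\<in>V. cobd (\<psi> a) S)"
      unfolding \<sigma>_def using finite_V one_sided_sub_V[OF S] finite_sub psi
      by (intro cobd_finsum) (auto simp: Pi_def)
    also have "\<dots> = (\<Oplus>a\<in>V. \<phi> a S)"
      using psi_cobd S one_sided_sub_V[OF S] phi by (intro finsum_cong') (auto simp: Pi_def)
    finally show ?thesis using tau_one_sided[OF S] by simp
  qed
  have z: "z S \<in> carrier R" for S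
    unfolding z_def using vertex_cochain_closed by (intro cobd_closed) auto
  have z_deg: "graded 2 z"
    unfolding z_def using graded_cobd[OF graded_vertex_cochain] by simp
  have r: "r \<in> Pow V \<rightarrow> carrier R"
    using tau dsg by (auto simp: r_def Pi_def)
  have r_deg: "graded i r"
    using deg(2) dsg_deg by (auto simp: graded_def r_def minus_eq)
  have ab: "{a\<^sub>0, b\<^sub>0} \<subseteq> V" using a0_V b0_V by simp
  have t: "t \<in> carrier R"
    using r z ab by (auto simp: t_def Pi_def)
  have t0: "t = \<zero>" if "i \<noteq> 2"
    using that r_deg z ab a0_b0 by (simp add: graded_def t_def)
  have cc: "c \<in> Pow V \<rightarrow> carrier R"
    using r z t by (auto simp: c_def Pi_def)
  have c_one_sided: "c S = \<zero>" if S: "one_sided S" for S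
    using S one_sided_sub_V[OF S] tau t cobd_vertex_cochain_one_sided[OF S]
    by (simp add: c_def r_def sg_one_sided z_def minus_eq r_neg Pi_def)
  have c_closed: "cobd c S = \<zero>" if S: "S \<subseteq> V" for S
  proof -
    have "cobd c S = cobd r S \<ominus> cobd (\<lambda>T. t \<otimes> z T) S"
      unfolding c_def using r z t S finite_sub by (intro cobd_minus) (auto simp: Pi_def)
    also have "cobd (\<lambda>T. t \<otimes> z T) S = t \<otimes> cobd z S"
      using z t S finite_sub by (intro cobd_smult) auto
    also have "cobd z S = \<zero>"
      unfolding z_def using S vertex_cochain_closed by (intro cobd_cobd) auto
    also have "cobd r S = cobd \<tau> S \<ominus> cobd (cobd \<sigma>) S"
      unfolding r_def using tau dsg S finite_sub by (intro cobd_minus) (auto simp: Pi_def)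
    also have "cobd (cobd \<sigma>) S = \<zero>"
      using S sg by (intro cobd_cobd) (auto simp: Pi_def)
    finally show ?thesis
      using t tau_closed[OF S] by (simp add: minus_eq)
  qed
  have "t \<otimes> z {a\<^sub>0, b\<^sub>0} = r {a\<^sub>0, b\<^sub>0}"
    using r z ab cobd_vertex_cochain_square by (simp add: t_def z_def m_assoc Pi_def)
  then have c_pair: "c {a\<^sub>0, b\<^sub>0} = \<zero>"
    using r ab by (simp add: c_def minus_eq r_neg Pi_def)
  have c_deg: "graded i c"
    using r_deg z_deg t0 t z by (cases "i = 2") (auto simp: graded_def c_def minus_eq)
  obtain m where m: "m \<in> Pow V \<rightarrow> carrier R" "graded (i - 1) m"
    "\<And>S. one_sided S \<Longrightarrow> m S = \<zero>" "\<And>S. S \<subseteq> V \<Longrightarrow> cobd m S = c S"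
    using two_sided_exact[OF cc c_one_sided c_closed c_pair c_deg] by blast
  have "\<tau> S = cobd (\<lambda>T. m T \<oplus> (\<Oplus>a\<in>V. \<psi> a T)) S \<oplus> t \<otimes> cobd vertex_cochain S" if S: "S \<subseteq> V" for S
  proof -
    have "cobd (\<lambda>T. m T \<oplus> \<sigma> T) S = c S \<oplus> cobd \<sigma> S"
      using m sg S by (subst cobd_add) (auto simp: Pi_def)
    moreover have "\<tau> S \<in> carrier R" "cobd \<sigma> S \<in> carrier R"
      using tau dsg S by auto
    moreover have "x \<ominus> s \<ominus> y \<oplus> s \<oplus> y = x"
      if "x \<in> carrier R" "s \<in> carrier R" "y \<in> carrier R" for x s y
    proof -
      have "x \<ominus> s \<ominus> y \<oplus> s \<oplus> y = x \<oplus> (\<ominus> s \<oplus> s) \<oplus> (\<ominus> y \<oplus> y)"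
        using that unfolding minus_eq by (simp only: a_ac a_closed a_inv_closed)
      then show ?thesis using that by (simp add: l_neg)
    qed
    ultimately show ?thesis
      using t z[of S] unfolding c_def r_def \<sigma>_def z_def by simp
  qed
  then show thesis
    using that[of \<psi> m t] psi psi_supp psi_deg psi_cobd m(1-3) t t0 by blast
qed

end

section \<open>The bold complex of a graph\<close>

locale bold_complex = field K + graph G
  for K (structure) and G :: "('a, 'b) pre_digraph" +
  fixes s :: "('a \<Rightarrow> nat) \<Rightarrow> ('a \<Rightarrow> nat) \<Rightarrow> bit"
  assumes sign_assignment: "sign_assignment G s"
begin

definition colouring :: "'a set \<Rightarrow> 'a \<Rightarrow> nat" where
  "colouring S = (\<lambda>v\<in>verts G. if v \<in> S then 1 else 0)"

definition edge_sign :: "'a set \<Rightarrow> 'a \<Rightarrow> _" where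
  "edge_sign S v = sign_of K (s (colouring S) (colouring (insert v S)))"

lemma colouring_bicolouring: "colouring S \<in> bicolourings G"
  by (auto simp: colouring_def bicolourings_def)

lemma bicolouring_cases:
  assumes "\<epsilon> \<in> bicolourings G"
  obtains S where "S \<subseteq> verts G" "\<epsilon> = colouring S"
proof
  show "{v \<in> verts G. \<epsilon> v = 1} \<subseteq> verts G" by auto
  show "\<epsilon> = colouring {v \<in> verts G. \<epsilon> v = 1}"
    using assms by (force simp: bicolourings_def colouring_def PiE_iff extensional_def restrict_def fun_eq_iff)
qed

lemma colouring_inj:
  assumes "S \<subseteq> verts G" "T \<subseteq> verts G" "colouring S = colouring T"
  shows "S = T"
proof -
  have "S = {v \<in> verts G. colouring S v = 1}" "T = {v \<in> verts G. colouring T v = 1}"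
    using assms(1,2) by (auto simp: colouring_def split: if_splits)
  then show ?thesis using assms(3) by simp
qed

lemma sum_colouring: "S \<subseteq> verts G \<Longrightarrow> (\<Sum>v\<in>verts G. colouring S v) = card S"
  by (simp add: colouring_def sum.If_cases Int_absorb1)

lemma coloured_subgraph_colouring:
  "S \<subseteq> verts G \<Longrightarrow> coloured_subgraph G (colouring S) = G \<restriction> S"
proof -
  assume "S \<subseteq> verts G"
  then have "{v \<in> verts G. colouring S v = 1} = S"
    by (auto simp: colouring_def split: if_splits)
  then show ?thesis by (simp add: coloured_subgraph_def)
qed

lemma bicolouring_step_colouring:
  assumes "S \<subseteq> verts G"
  shows "bicolouring_step G \<epsilon> (colouring S) \<longleftrightarrow> (\<exists>v\<in>S. \<epsilon> = colouring (S - {v}))"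
proof
  assume "bicolouring_step G \<epsilon> (colouring S)"
  then obtain v where v: "\<epsilon> \<in> bicolourings G" "v \<in> verts G" "\<epsilon> v = 0" "colouring S = \<epsilon>(v := 1)"
    unfolding bicolouring_step_def by blast
  then obtain T where T: "T \<subseteq> verts G" "\<epsilon> = colouring T"
    using bicolouring_cases by blast
  have "colouring S = colouring (insert v T)" "v \<notin> T"
    using v T by (auto simp: colouring_def fun_eq_iff split: if_splits)
  then have "S = insert v T"
    using colouring_inj[OF assms, of "insert v T"] v(2) T(1) by simp
  with \<open>v \<notin> T\<close> T(2) show "\<exists>v\<in>S. \<epsilon> = colouring (S - {v})" by auto
next
  assume "\<exists>v\<in>S. \<epsilon> = colouring (S - {v})"
  then obtain v where v: "v \<in> S" "\<epsilon> = colouring (S - {v})" by blast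
  then have "\<epsilon> v = 0" "colouring S = \<epsilon>(v := 1)" "v \<in> verts G"
    using assms by (auto simp: colouring_def fun_eq_iff)
  then show "bicolouring_step G \<epsilon> (colouring S)"
    using v colouring_bicolouring unfolding bicolouring_step_def by blast
qed

lemma bicolouring_step_insert:
  assumes "S \<subseteq> verts G" "v \<in> verts G - S"
  shows "bicolouring_step G (colouring S) (colouring (insert v S))"
  using assms by (subst bicolouring_step_colouring) auto

lemma sign_of_closed: "sign_of K b \<in> carrier K"
  by (simp add: sign_of_def)

lemma sign_of_add: "sign_of K (b + c) = sign_of K b \<otimes> sign_of K c"
  by (cases b; cases c) (simp_all add: sign_of_def l_minus r_minus)

lemma sign_of_square: "sign_of K b \<otimes> sign_of K b = \<one>"
  by (cases b) (simp_all add: sign_of_def l_minus r_minus)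

lemma sign_of_add_one: "sign_of K (b + 1) = \<ominus> sign_of K b"
  by (cases b) (simp_all add: sign_of_def)

lemma signed_cube: "signed_cube K (verts G) edge_sign"
proof
  fix S v w assume S: "S \<subseteq> verts G" "v \<in> verts G - S" "w \<in> verts G - S" "v \<noteq> w"
  have "colouring (insert v S) \<noteq> colouring (insert w S)"
    using colouring_inj[of "insert v S" "insert w S"] S by auto
  then have "s (colouring S) (colouring (insert v S))
      + s (colouring (insert v S)) (colouring (insert w (insert v S)))
    = s (colouring S) (colouring (insert w S))
      + s (colouring (insert w S)) (colouring (insert w (insert v S))) + 1"
    using sign_assignment bicolouring_step_insert[of S v] bicolouring_step_insert[of S w]
      bicolouring_step_insert[of "insert v S" w] bicolouring_step_insert[of "insert w S" v] S
    unfolding sign_assignment_def by (auto simp: insert_commute)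
  from arg_cong[OF this, of "sign_of K"]
  have "sign_of K (s (colouring S) (colouring (insert v S)))
      \<otimes> sign_of K (s (colouring (insert v S)) (colouring (insert w (insert v S))))
    = \<ominus> (sign_of K (s (colouring S) (colouring (insert w S)))
      \<otimes> sign_of K (s (colouring (insert w S)) (colouring (insert w (insert v S)))))"
    unfolding sign_of_add_one unfolding sign_of_add .
  then show "edge_sign S v \<otimes> edge_sign (insert v S) w = \<ominus> (edge_sign S w \<otimes> edge_sign (insert w S) v)"
    by (simp add: edge_sign_def insert_commute)
qed (auto simp: edge_sign_def sign_of_closed sign_of_square)

lemma finite_components:
  assumes "S \<subseteq> verts G"
  shows "finite (components (G \<restriction> S))"
proof (rule finite_subset)
  show "components (G \<restriction> S) \<subseteq> (\<lambda>(X, E). \<lparr>verts = X, arcs = E, tail = tail G, head = head G\<rparr>)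
      ` (Pow S \<times> Pow (arcs G))"
  proof
    fix H assume "H \<in> components (G \<restriction> S)"
    then have "subgraph H (G \<restriction> S)"
      by (simp add: components_def pre_digraph.max_subgraph_def)
    then have "verts H \<subseteq> S" "arcs H \<subseteq> arcs G" "tail H = tail G" "head H = head G"
      by (auto simp: subgraph_def compatible_def)
    then show "H \<in> (\<lambda>(X, E). \<lparr>verts = X, arcs = E, tail = tail G, head = head G\<rparr>)
      ` (Pow S \<times> Pow (arcs G))"
      by (intro image_eqI[of _ _ "(verts H, arcs H)"]) auto
  qed
  show "finite ((\<lambda>(X, E). \<lparr>verts = X, arcs = E, tail = tail G, head = head G\<rparr>)
      ` (Pow S \<times> Pow (arcs G)))"
    using finite_subset[OF assms finite_verts] by auto
qed

lemma mem_bold_gens: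
  assumes "S \<subseteq> verts G"
  shows "(colouring S, x) \<in> bold_gens G i \<longleftrightarrow> int (card S) = i \<and> x \<in> components (G \<restriction> S)"
  using assms colouring_bicolouring
  by (simp add: bold_gens_def sum_colouring coloured_subgraph_colouring del: of_nat_sum)

lemma bold_gens_cases:
  assumes "h \<in> bold_gens G i"
  obtains S x where "h = (colouring S, x)" "S \<subseteq> verts G" "int (card S) = i"
    "x \<in> components (G \<restriction> S)"
proof -
  obtain \<epsilon> x where h: "h = (\<epsilon>, x)" "\<epsilon> \<in> bicolourings G"
    using assms by (auto simp: bold_gens_def)
  then obtain S where "S \<subseteq> verts G" "\<epsilon> = colouring S"
    using bicolouring_cases by blast
  then show thesis
    using that h assms mem_bold_gens by auto
qed

lemma finite_bold_gens: "finite (bold_gens G i)"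
proof (rule finite_subset)
  show "bold_gens G i \<subseteq> (\<Union>S\<in>Pow (verts G). Pair (colouring S) ` components (G \<restriction> S))"
    by (auto elim!: bold_gens_cases)
  show "finite (\<Union>S\<in>Pow (verts G). Pair (colouring S) ` components (G \<restriction> S))"
    using finite_components by auto
qed

lemma bold_chains_module: "module K (bold_chains K G i)"
  unfolding bold_chains_def by (rule func_space_is_module)

lemma bold_chains_simps:
  "carrier (bold_chains K G i) = bold_gens G i \<rightarrow>\<^sub>E carrier K"
  "\<zero>\<^bsub>bold_chains K G i\<^esub> = (\<lambda>h\<in>bold_gens G i. \<zero>)"
  "c \<oplus>\<^bsub>bold_chains K G i\<^esub> c' = (\<lambda>h\<in>bold_gens G i. c h \<oplus> c' h)"
  "a \<odot>\<^bsub>bold_chains K G i\<^esub> c = (\<lambda>h\<in>bold_gens G i. a \<otimes> c h)"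
  by (simp_all add: bold_chains_def func_space_def)

lemma bold_chain_value: "c \<in> carrier (bold_chains K G i) \<Longrightarrow> h \<in> bold_gens G i \<Longrightarrow> c h \<in> carrier K"
  by (auto simp: bold_chains_simps)

subsection \<open>The differential in coordinates\<close>

definition covers :: "('a \<Rightarrow> nat) \<times> ('a, 'b) pre_digraph \<Rightarrow>
    (('a \<Rightarrow> nat) \<times> ('a, 'b) pre_digraph) set" where
  "covers g = {(\<epsilon>', y). bicolouring_step G (fst g) \<epsilon>' \<and>
     y \<in> components (coloured_subgraph G \<epsilon>') \<and> verts (snd g) \<subseteq> verts y}"

definition incidence :: "('a \<Rightarrow> nat) \<times> ('a, 'b) pre_digraph \<Rightarrow>
    ('a \<Rightarrow> nat) \<times> ('a, 'b) pre_digraph \<Rightarrow> _" where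
  "incidence g h = (if h \<in> covers g then sign_of K (s (fst g) (fst h)) else \<zero>)"

lemma incidence_closed: "incidence g h \<in> carrier K"
  by (simp add: incidence_def sign_of_closed)

lemma covers_subset:
  assumes "g \<in> bold_gens G i"
  shows "covers g \<subseteq> bold_gens G (i + 1)"
proof
  fix h assume h: "h \<in> covers g"
  obtain S x where g: "g = (colouring S, x)" "S \<subseteq> verts G" "int (card S) = i"
    using assms by (rule bold_gens_cases)
  obtain \<epsilon>' y where h': "h = (\<epsilon>', y)" "bicolouring_step G (colouring S) \<epsilon>'"
    "y \<in> components (coloured_subgraph G \<epsilon>')"
    using h g by (auto simp: covers_def)
  obtain v where v: "v \<in> verts G" "colouring S v = 0" "\<epsilon>' = (colouring S)(v := 1)"
    using h'(2) unfolding bicolouring_step_def by blast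
  then have "v \<notin> S" "\<epsilon>' = colouring (insert v S)"
    by (auto simp: colouring_def fun_eq_iff)
  moreover have "finite S" using finite_subset[OF g(2) finite_verts] .
  ultimately show "h \<in> bold_gens G (i + 1)"
    using h' v g coloured_subgraph_colouring by (simp add: mem_bold_gens)
qed

lemma bold_diff_gen_eq:
  assumes "g \<in> bold_gens G i"
  shows "bold_diff_gen K G s i g = (\<lambda>h\<in>bold_gens G (i + 1). incidence g h)"
proof -
  let ?C = "bold_chains K G (i + 1)"
  obtain \<epsilon> x where g: "g = (\<epsilon>, x)" by (cases g)
  have "bold_diff_gen K G s i g = (\<Oplus>\<^bsub>?C\<^esub>h\<in>covers g.
      sign_of K (s \<epsilon> (fst h)) \<odot>\<^bsub>?C\<^esub> bold_basis K G (i + 1) h)"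
    by (simp add: bold_diff_gen_def covers_def g)
  also have "\<dots> = (\<lambda>k\<in>bold_gens G (i + 1). \<Oplus>h\<in>covers g.
      (sign_of K (s \<epsilon> (fst h)) \<odot>\<^bsub>?C\<^esub> bold_basis K G (i + 1) h) k)"
    unfolding bold_chains_def
    by (rule finsum_func_space) (auto simp: func_space_def bold_basis_def sign_of_closed)
  also have "\<dots> = (\<lambda>k\<in>bold_gens G (i + 1). incidence g k)"
  proof (intro restrict_ext)
    fix k assume k: "k \<in> bold_gens G (i + 1)"
    have "(\<Oplus>h\<in>covers g. (sign_of K (s \<epsilon> (fst h)) \<odot>\<^bsub>?C\<^esub> bold_basis K G (i + 1) h) k)
      = (\<Oplus>h\<in>covers g. if h = k then sign_of K (s \<epsilon> (fst h)) else \<zero>)"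
      using k by (intro finsum_cong')
        (auto simp: bold_chains_simps bold_basis_def sign_of_closed)
    also have "\<dots> = incidence g k"
    proof (cases "k \<in> covers g")
      case True
      have "finite (covers g)"
        using covers_subset[OF assms] finite_bold_gens finite_subset by blast
      then show ?thesis
        using True by (subst add.finprod_singleton_swap)
          (auto simp: sign_of_closed incidence_def g)
    next
      case False
      then show ?thesis
        by (auto simp: incidence_def intro!: add.finprod_one_eqI)
    qed
    finally show "(\<Oplus>h\<in>covers g. (sign_of K (s \<epsilon> (fst h)) \<odot>\<^bsub>?C\<^esub> bold_basis K G (i + 1) h) k)
      = incidence g k" .
  qed
  finally show ?thesis .
qed

lemma bold_diff_eq:
  assumes c: "c \<in> carrier (bold_chains K G i)"
  shows "bold_diff K G s i c =
    (\<lambda>h\<in>bold_gens G (i + 1). \<Oplus>g\<in>bold_gens G i. c g \<otimes> incidence g h)"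
proof -
  let ?C = "bold_chains K G (i + 1)"
  have "bold_diff K G s i c = (\<lambda>h\<in>bold_gens G (i + 1).
      \<Oplus>g\<in>bold_gens G i. (c g \<odot>\<^bsub>?C\<^esub> bold_diff_gen K G s i g) h)"
    unfolding bold_diff_def bold_chains_def
    by (rule finsum_func_space)
      (use c in \<open>auto simp: func_space_def bold_diff_gen_eq incidence_closed bold_chain_value\<close>)
  also have "\<dots> = (\<lambda>h\<in>bold_gens G (i + 1). \<Oplus>g\<in>bold_gens G i. c g \<otimes> incidence g h)"
    using c by (intro restrict_ext finsum_cong')
      (auto simp: bold_chains_simps bold_diff_gen_eq incidence_closed bold_chain_value)
  finally show ?thesis .
qed

lemma bold_diff_mod_hom:
  "mod_hom K (bold_chains K G i) (bold_chains K G (i + 1)) (bold_diff K G s i)"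
proof -
  let ?C = "bold_chains K G i" and ?D = "bold_chains K G (i + 1)" and ?d = "bold_diff K G s i"
  interpret C: module K ?C by (rule bold_chains_module)
  have "?d c \<in> carrier ?D" if "c \<in> carrier ?C" for c
    using bold_chain_value[OF that] that
    by (auto simp: bold_diff_eq bold_chains_simps(1)[where i = "i + 1"] incidence_closed
        intro!: finsum_closed)
  moreover have "?d (c \<oplus>\<^bsub>?C\<^esub> c') = ?d c \<oplus>\<^bsub>?D\<^esub> ?d c'"
    if "c \<in> carrier ?C" "c' \<in> carrier ?C" for c c'
  proof -
    note cl = bold_chain_value[OF that(1)] bold_chain_value[OF that(2)]
    have "(\<Oplus>g\<in>bold_gens G i. (c \<oplus>\<^bsub>?C\<^esub> c') g \<otimes> incidence g h)
        = (\<Oplus>g\<in>bold_gens G i. c g \<otimes> incidence g h \<oplus> c' g \<otimes> incidence g h)" for h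
      using cl by (intro finsum_cong')
        (auto simp: bold_chains_simps l_distr incidence_closed)
    also have "\<dots> h = (\<Oplus>g\<in>bold_gens G i. c g \<otimes> incidence g h)
        \<oplus> (\<Oplus>g\<in>bold_gens G i. c' g \<otimes> incidence g h)" for h
      using cl by (intro finsum_addf) (auto simp: incidence_closed)
    finally show ?thesis
      using that by (simp add: bold_diff_eq bold_chains_simps(3)[where i = "i + 1"] cong: restrict_cong)
  qed
  moreover have "?d (a \<odot>\<^bsub>?C\<^esub> c) = a \<odot>\<^bsub>?D\<^esub> ?d c" if "a \<in> carrier K" "c \<in> carrier ?C" for a c
  proof -
    note cl = bold_chain_value[OF that(2)]
    have "(\<Oplus>g\<in>bold_gens G i. (a \<odot>\<^bsub>?C\<^esub> c) g \<otimes> incidence g h)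
        = (\<Oplus>g\<in>bold_gens G i. a \<otimes> (c g \<otimes> incidence g h))" for h
      using cl that by (intro finsum_cong')
        (auto simp: bold_chains_simps m_assoc incidence_closed)
    also have "\<dots> h = a \<otimes> (\<Oplus>g\<in>bold_gens G i. c g \<otimes> incidence g h)" for h
      using cl that by (intro finsum_rdistr[symmetric])
        (auto simp: incidence_closed finite_bold_gens)
    finally show ?thesis
      using that by (simp add: bold_diff_eq bold_chains_simps(4)[where i = "i + 1"] cong: restrict_cong)
  qed
  ultimately show ?thesis
    using bold_chains_module
    by (auto simp: mod_hom_def mod_hom_axioms_def module_hom_def)
qed

text \<open>
  The generators with a non-zero coefficient are grouped by the vertex whose colour changes.
\<close>

lemma bold_diff_apply:
  assumes c: "c \<in> carrier (bold_chains K G i)"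
    and S: "S \<subseteq> verts G" "int (card S) = i + 1" and y: "y \<in> components (G \<restriction> S)"
  shows "bold_diff K G s i c (colouring S, y) =
    (\<Oplus>v\<in>S. edge_sign (S - {v}) v \<otimes>
      (\<Oplus>x\<in>{x \<in> components (G \<restriction> (S - {v})). verts x \<subseteq> verts y}. c (colouring (S - {v}), x)))"
proof -
  define X where "X v = {x \<in> components (G \<restriction> (S - {v})). verts x \<subseteq> verts y}" for v
  define P where "P v = Pair (colouring (S - {v})) ` X v" for v
  have finS: "finite S" using finite_subset[OF S(1) finite_verts] .
  have finX: "finite (X v)" for v
  proof -
    have "S - {v} \<subseteq> verts G" using S(1) by blast
    then show ?thesis unfolding X_def by (simp add: finite_components)
  qed
  have gens: "(colouring (S - {v}), x) \<in> bold_gens G i" if "v \<in> S" "x \<in> X v" for v x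
  proof -
    have "int (card (S - {v})) = i"
      using card.remove[OF finS that(1)] S(2) by linarith
    moreover have "S - {v} \<subseteq> verts G" using S(1) by blast
    ultimately show ?thesis using that(2) by (simp add: mem_bold_gens X_def)
  qed
  have cl: "c (colouring (S - {v}), x) \<in> carrier K" if "v \<in> S" "x \<in> X v" for v x
    using gens[OF that] c by (rule bold_chain_value[rotated])
  have cov: "(colouring S, y) \<in> covers (colouring (S - {v}), x)" if "v \<in> S" "x \<in> X v" for v x
    using that S y by (auto simp: covers_def X_def bicolouring_step_colouring
        coloured_subgraph_colouring)
  have out: "(colouring S, y) \<notin> covers g" if g: "g \<in> bold_gens G i - (\<Union>v\<in>S. P v)" for g
  proof
    assume "(colouring S, y) \<in> covers g"
    then obtain v where v: "v \<in> S" "fst g = colouring (S - {v})" "verts (snd g) \<subseteq> verts y"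
      using S(1) by (auto simp: covers_def bicolouring_step_colouring)
    moreover have "snd g \<in> components (G \<restriction> (S - {v}))"
      using g v S(1) mem_bold_gens[of "S - {v}" "snd g" i] by (cases g) auto
    ultimately have "g \<in> P v"
      by (auto simp: P_def X_def intro!: image_eqI[of _ _ "snd g"] prod_eqI)
    then show False using g v by auto
  qed
  have "bold_diff K G s i c (colouring S, y)
      = (\<Oplus>g\<in>bold_gens G i. c g \<otimes> incidence g (colouring S, y))"
    using c S y by (simp add: bold_diff_eq mem_bold_gens)
  also have "\<dots> = (\<Oplus>g\<in>(\<Union>v\<in>S. P v). c g \<otimes> incidence g (colouring S, y))"
  proof (rule add.finprod_mono_neutral_cong_right)
    show "(\<Union>v\<in>S. P v) \<subseteq> bold_gens G i" using gens by (auto simp: P_def)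
    show "c g \<otimes> incidence g (colouring S, y) = \<zero>" if "g \<in> bold_gens G i - (\<Union>v\<in>S. P v)" for g
      using out[OF that] that c by (simp add: incidence_def bold_chain_value)
  qed (use c in \<open>auto simp: finite_bold_gens incidence_closed bold_chain_value\<close>)
  also have "\<dots> = (\<Oplus>v\<in>S. \<Oplus>g\<in>P v. c g \<otimes> incidence g (colouring S, y))"
  proof (rule add.finprod_UN_disjoint)
    have "v = w" if "v \<in> S" "w \<in> S" "colouring (S - {v}) = colouring (S - {w})" for v w
      using colouring_inj[of "S - {v}" "S - {w}"] that S(1) by auto
    then show "pairwise (\<lambda>v w. disjnt (P v) (P w)) S"
      by (auto simp: pairwise_def disjnt_def P_def)
  qed (use finS finX cl in \<open>auto simp: P_def incidence_closed\<close>)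
  also have "\<dots> = (\<Oplus>v\<in>S. edge_sign (S - {v}) v \<otimes> (\<Oplus>x\<in>X v. c (colouring (S - {v}), x)))"
  proof (intro finsum_cong')
    fix v assume v: "v \<in> S"
    have "(\<Oplus>g\<in>P v. c g \<otimes> incidence g (colouring S, y))
        = (\<Oplus>x\<in>X v. c (colouring (S - {v}), x) \<otimes> incidence (colouring (S - {v}), x) (colouring S, y))"
      unfolding P_def using v cl by (intro finsum_reindex) (auto simp: incidence_closed inj_on_def)
    also have "\<dots> = (\<Oplus>x\<in>X v. edge_sign (S - {v}) v \<otimes> c (colouring (S - {v}), x))"
      using v cl cov by (intro finsum_cong')
        (auto simp: incidence_def edge_sign_def insert_absorb[OF v] sign_of_closed m_comm)
    also have "\<dots> = edge_sign (S - {v}) v \<otimes> (\<Oplus>x\<in>X v. c (colouring (S - {v}), x))"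
      using v cl finX by (intro finsum_rdistr[symmetric]) (auto simp: edge_sign_def sign_of_closed)
    finally show "(\<Oplus>g\<in>P v. c g \<otimes> incidence g (colouring S, y)) = \<dots>" .
  qed (use cl in \<open>auto simp: edge_sign_def sign_of_closed intro!: finsum_closed\<close>)
  finally show ?thesis unfolding X_def .
qed

end

section \<open>Complete bipartite graphs\<close>

lemma subgraph_antisym:
  fixes H F :: "('a, 'b) pre_digraph"
  assumes "subgraph H F" "subgraph F H"
  shows "H = F"
  using assms by (auto simp: subgraph_def compatible_def intro!: pre_digraph.equality)

lemma components_connected:
  assumes "wf_digraph F" "connected F"
  shows "components F = {F}"
proof -
  interpret wf_digraph F by fact
  have "max_subgraph connected F"
    using assms(2) subgraph_refl unfolding max_subgraph_def by (blast dest: subgraph_antisym)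
  moreover have "H = F" if "max_subgraph connected H" for H
    using that assms(2) subgraph_refl unfolding max_subgraph_def by metis
  ultimately show ?thesis by (auto simp: components_def)
qed

lemma connected_without_arcs:
  assumes "arcs H = {}"
  shows "connected H \<longleftrightarrow> (\<exists>v. verts H = {v})"
proof -
  have "u = v" if "u \<rightarrow>\<^sup>*\<^bsub>with_proj (mk_symmetric H)\<^esub> v" for u v
    using that assms
    by (auto simp: reachable_def parcs_mk_symmetric dest: rtrancl_on_rtranclI)
  moreover have "v \<rightarrow>\<^sup>*\<^bsub>with_proj (mk_symmetric H)\<^esub> v" if "v \<in> verts H" for v
    using that by (simp add: reachable_def)
  ultimately show ?thesis
    by (auto simp: connected_def strongly_connected_def) blast
qed

lemma components_without_arcs:
  assumes "wf_digraph F" "arcs F = {}"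
  shows "components F = (\<lambda>v. F \<restriction> {v}) ` verts F"
proof -
  interpret wf_digraph F by fact
  have conn: "(subgraph H F \<and> connected H) \<longleftrightarrow> (\<exists>v\<in>verts F. H = F \<restriction> {v})" for H
  proof
    assume H: "subgraph H F \<and> connected H"
    then have "arcs H = {}" using assms(2) by (auto simp: subgraph_def)
    then obtain v where v: "verts H = {v}"
      using H connected_without_arcs by blast
    then have "H = F \<restriction> {v}"
      using H \<open>arcs H = {}\<close> assms(2)
      by (auto simp: subgraph_def compatible_def intro!: pre_digraph.equality)
    then show "\<exists>v\<in>verts F. H = F \<restriction> {v}" using H v by (auto simp: subgraph_def)
  next
    assume "\<exists>v\<in>verts F. H = F \<restriction> {v}"
    then obtain v where v: "v \<in> verts F" "H = F \<restriction> {v}" by blast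
    then show "subgraph H F \<and> connected H"
      using assms(2) connected_without_arcs[of H] subgraph_induce_subgraphI[of "{v}"] by auto
  qed
  have "max_subgraph connected H \<longleftrightarrow> (\<exists>v\<in>verts F. H = F \<restriction> {v})" for H
  proof
    assume "max_subgraph connected H"
    then show "\<exists>v\<in>verts F. H = F \<restriction> {v}"
      using conn[of H] unfolding max_subgraph_def by blast
  next
    assume H: "\<exists>v\<in>verts F. H = F \<restriction> {v}"
    have "H' = H" if H': "subgraph H H'" "subgraph H' F" "connected H'" for H'
    proof -
      obtain v w where "H = F \<restriction> {v}" "H' = F \<restriction> {w}"
        using H H' conn[of H'] by blast
      then show ?thesis
        using subgraph_imp_subverts[OF H'(1)] by simp
    qed
    then show "max_subgraph connected H"
      using H conn[of H] unfolding max_subgraph_def by blast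
  qed
  then show ?thesis by (auto simp: components_def)
qed

locale bipartite_bold = bold_complex K G s
  for K (structure) and G :: "('a, 'b) pre_digraph" and s +
  fixes A B :: "'a set" and a\<^sub>0 b\<^sub>0 :: 'a and partner :: "'a \<Rightarrow> 'a"
  assumes verts_eq: "verts G = A \<union> B" and parts_disjoint: "A \<inter> B = {}"
    and arcs_ends_eq: "arcs_ends G = A \<times> B \<union> B \<times> A"
    and a0_in: "a\<^sub>0 \<in> A" and b0_in: "b\<^sub>0 \<in> B"
    and partner_in_A: "a \<in> A \<Longrightarrow> partner a \<in> A - {a}"
    and partner_in_B: "b \<in> B \<Longrightarrow> partner b \<in> B - {b}"
begin

sublocale bipartite_cube K "verts G" edge_sign A B a\<^sub>0 b\<^sub>0 partner
  by (intro bipartite_cube.intro signed_cube bipartite_cube_axioms.intro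
      verts_eq parts_disjoint a0_in b0_in partner_in_A partner_in_B)

lemma arcs_one_sided: "one_sided S \<Longrightarrow> arcs (G \<restriction> S) = {}"
proof -
  assume S: "one_sided S"
  have "(tail G e, head G e) \<in> A \<times> B \<union> B \<times> A" if "e \<in> arcs G" for e
    using that by (auto simp flip: arcs_ends_eq simp: arcs_ends_conv)
  then show ?thesis
    using S parts_disjoint by (fastforce simp: one_sided_def)
qed

lemma components_one_sided:
  assumes "one_sided S"
  shows "components (G \<restriction> S) = (\<lambda>v. G \<restriction> {v}) ` S"
proof -
  have "(G \<restriction> S) \<restriction> {v} = G \<restriction> {v}" if "v \<in> S" for v
    using arcs_one_sided[OF assms] arcs_one_sided[OF one_sided_subset[OF assms, of "{v}"]] that
    by (auto intro!: pre_digraph.equality)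
  then show ?thesis
    using components_without_arcs[OF wellformed_induce_subgraph arcs_one_sided[OF assms]]
    by (auto intro!: image_cong)
qed

lemma components_two_sided:
  assumes S: "S \<subseteq> verts G" "\<not> one_sided S"
  shows "components (G \<restriction> S) = {G \<restriction> S}"
proof (rule components_connected)
  show wf: "wf_digraph (G \<restriction> S)" by (rule wellformed_induce_subgraph)
  interpret F: wf_digraph "G \<restriction> S" by (rule wf)
  have adj: "u \<rightarrow>\<^bsub>G \<restriction> S\<^esub> v" if "u \<in> S" "v \<in> S" "(u, v) \<in> A \<times> B \<union> B \<times> A" for u v
  proof -
    have "(u, v) \<in> arcs_ends G" using that(3) by (simp add: arcs_ends_eq)
    then show ?thesis using that(1,2) by (auto simp: arcs_ends_conv)
  qed
  obtain a b where ab: "a \<in> S" "a \<in> A" "b \<in> S" "b \<in> B"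
    using S verts_eq by (auto simp: one_sided_def)
  have "u \<rightarrow>\<^sup>*\<^bsub>G \<restriction> S\<^esub> v" if uv: "u \<in> S" "v \<in> S" for u v
  proof -
    have *: "u \<rightarrow>\<^sup>*\<^bsub>G \<restriction> S\<^esub> a \<and> a \<rightarrow>\<^sup>*\<^bsub>G \<restriction> S\<^esub> u" if u: "u \<in> S" for u
    proof (cases "u \<in> A")
      case True
      then have "u \<rightarrow>\<^bsub>G \<restriction> S\<^esub> b" "b \<rightarrow>\<^bsub>G \<restriction> S\<^esub> a" "a \<rightarrow>\<^bsub>G \<restriction> S\<^esub> b" "b \<rightarrow>\<^bsub>G \<restriction> S\<^esub> u"
        using u ab adj by auto
      then show ?thesis
        using F.adj_reachable_trans F.reachable_adjI by blast
    next
      case False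
      then have "u \<in> B" using u S verts_eq by auto
      then show ?thesis using u ab adj by auto
    qed
    show ?thesis
      using *[OF uv(1)] *[OF uv(2)] F.reachable_trans by blast
  qed
  then show "connected (G \<restriction> S)"
    using F.reachable_mk_symmetricI ab
    by (auto simp: connected_def strongly_connected_def)
qed

subsection \<open>Coordinates of chains\<close>

text \<open>
  The point part at \<open>a\<close> follows the component \<open>{a}\<close>. The total forgets the components; this is
  the chain map to the cube that is induced by the augmentation of each \<open>\<pi>\<^sub>0\<close>. A chain is determined
  by its point parts and the values of its total at the sets that are not one-sided.
\<close>

definition point_part :: "int \<Rightarrow> (('a \<Rightarrow> nat) \<times> ('a, 'b) pre_digraph \<Rightarrow> _) \<Rightarrow> 'a \<Rightarrow> 'a set \<Rightarrow> _" where
  "point_part i c a S =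
    (if int (card S) = i \<and> one_sided S \<and> a \<in> S then c (colouring S, G \<restriction> {a}) else \<zero>)"

definition total :: "int \<Rightarrow> (('a \<Rightarrow> nat) \<times> ('a, 'b) pre_digraph \<Rightarrow> _) \<Rightarrow> 'a set \<Rightarrow> _" where
  "total i c S =
    (if int (card S) = i then \<Oplus>x\<in>components (G \<restriction> S). c (colouring S, x) else \<zero>)"

lemma point_gen:
  "\<lbrakk>one_sided S; a \<in> S; int (card S) = i\<rbrakk> \<Longrightarrow> (colouring S, G \<restriction> {a}) \<in> bold_gens G i"
  by (simp add: mem_bold_gens one_sided_sub_V components_one_sided)

lemma two_sided_gen:
  "\<lbrakk>S \<subseteq> verts G; \<not> one_sided S; int (card S) = i\<rbrakk> \<Longrightarrow> (colouring S, G \<restriction> S) \<in> bold_gens G i"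
  by (simp add: mem_bold_gens components_two_sided)

lemma bold_gens_one_sided_cases:
  assumes "h \<in> bold_gens G i"
  obtains (one_sided) S a where "one_sided S" "a \<in> S" "int (card S) = i" "h = (colouring S, G \<restriction> {a})"
  | (two_sided) S where "S \<subseteq> verts G" "\<not> one_sided S" "int (card S) = i" "h = (colouring S, G \<restriction> S)"
proof -
  obtain S x where S: "h = (colouring S, x)" "S \<subseteq> verts G" "int (card S) = i"
    "x \<in> components (G \<restriction> S)"
    using assms by (rule bold_gens_cases)
  show thesis
  proof (cases "one_sided S")
    case True
    then show ?thesis using S that(1) by (auto simp: components_one_sided)
  next
    case False
    then show ?thesis using S that(2) by (auto simp: components_two_sided)
  qed
qed

lemma point_part_closed:
  "c \<in> carrier (bold_chains K G i) \<Longrightarrow> point_part i c a S \<in> carrier K"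
  by (auto simp: point_part_def intro!: bold_chain_value point_gen)

lemma total_closed:
  "c \<in> carrier (bold_chains K G i) \<Longrightarrow> S \<subseteq> verts G \<Longrightarrow> total i c S \<in> carrier K"
  by (auto simp: total_def mem_bold_gens intro!: bold_chain_value finsum_closed)

lemma point_part_support: "\<not> (one_sided S \<and> a \<in> S) \<Longrightarrow> point_part i c a S = \<zero>"
  by (auto simp: point_part_def)

lemma graded_point_part: "graded i (point_part i c a)"
  and graded_total: "graded i (total i c)"
  by (auto simp: graded_def point_part_def total_def)

lemma total_two_sided:
  assumes "c \<in> carrier (bold_chains K G i)" "S \<subseteq> verts G" "\<not> one_sided S" "int (card S) = i"
  shows "total i c S = c (colouring S, G \<restriction> S)"
  using bold_chain_value[OF assms(1) two_sided_gen[OF assms(2-4)]] assms(2-4)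
  by (simp add: total_def components_two_sided)

lemma induce_point_inj: "inj_on (\<lambda>v. G \<restriction> {v}) S"
proof (rule inj_onI)
  fix u v assume "G \<restriction> {u} = G \<restriction> {v}"
  from arg_cong[OF this, of verts] show "u = v" by simp
qed

lemma total_one_sided:
  assumes c: "c \<in> carrier (bold_chains K G i)" and S: "one_sided S"
  shows "total i c S = (\<Oplus>a\<in>verts G. point_part i c a S)"
proof (cases "int (card S) = i")
  case True
  have cl: "c (colouring S, G \<restriction> {a}) \<in> carrier K" if "a \<in> S" for a
    using bold_chain_value[OF c point_gen[OF S that True]] .
  have "total i c S = (\<Oplus>a\<in>S. c (colouring S, G \<restriction> {a}))"
    using True S cl induce_point_inj unfolding total_def components_one_sided[OF S]
    by (subst finsum_reindex) auto
  also have "\<dots> = (\<Oplus>a\<in>verts G. point_part i c a S)"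
    using True S cl one_sided_sub_V[OF S]
    by (intro add.finprod_mono_neutral_cong_left) (auto simp: point_part_def)
  finally show ?thesis .
qed (auto simp: total_def point_part_def intro!: add.finprod_one_eqI[symmetric])

lemma chain_eqI:
  assumes c: "c \<in> carrier (bold_chains K G i)" and c': "c' \<in> carrier (bold_chains K G i)"
    and point: "\<And>a S. \<lbrakk>one_sided S; a \<in> S; int (card S) = i\<rbrakk> \<Longrightarrow> point_part i c a S = point_part i c' a S"
    and two_sided: "\<And>S. \<lbrakk>S \<subseteq> verts G; \<not> one_sided S; int (card S) = i\<rbrakk> \<Longrightarrow> total i c S = total i c' S"
  shows "c = c'"
proof (rule PiE_ext)
  show "c \<in> bold_gens G i \<rightarrow>\<^sub>E carrier K" "c' \<in> bold_gens G i \<rightarrow>\<^sub>E carrier K"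
    using c c' by (auto simp: bold_chains_simps)
  fix h assume "h \<in> bold_gens G i"
  then show "c h = c' h"
  proof (cases rule: bold_gens_one_sided_cases)
    case (one_sided S a)
    then show ?thesis using point[of S a] by (simp add: point_part_def)
  next
    case (two_sided S)
    then show ?thesis using assms(4)[of S] total_two_sided c c' by simp
  qed
qed

text \<open>
  On a one-sided set every component is a single vertex, which the description operator recovers.
\<close>

definition chain_of :: "int \<Rightarrow> ('a \<Rightarrow> 'a set \<Rightarrow> _) \<Rightarrow> ('a set \<Rightarrow> _) \<Rightarrow>
    ('a \<Rightarrow> nat) \<times> ('a, 'b) pre_digraph \<Rightarrow> _" where
  "chain_of i f m = (\<lambda>(\<epsilon>, x)\<in>bold_gens G i.
    let S = {v \<in> verts G. \<epsilon> v = 1} in if one_sided S then f (THE a. verts x = {a}) S else m S)"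

lemma chain_of_apply:
  assumes "(colouring S, x) \<in> bold_gens G i" "S \<subseteq> verts G"
  shows "chain_of i f m (colouring S, x) = (if one_sided S then f (THE a. verts x = {a}) S else m S)"
proof -
  have "{v \<in> verts G. colouring S v = 1} = S"
    using assms(2) by (auto simp: colouring_def split: if_splits)
  then show ?thesis using assms(1) by (simp add: chain_of_def)
qed

lemma chain_of_closed:
  assumes "\<And>a. a \<in> verts G \<Longrightarrow> f a \<in> Pow (verts G) \<rightarrow> carrier K" "m \<in> Pow (verts G) \<rightarrow> carrier K"
  shows "chain_of i f m \<in> carrier (bold_chains K G i)"
proof -
  have "chain_of i f m h \<in> carrier K" if h: "h \<in> bold_gens G i" for h
    using h
  proof (cases rule: bold_gens_one_sided_cases)
    case (one_sided S a)
    then show ?thesis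
      using h assms(1)[of a] one_sided_sub_V[of S] by (auto simp: chain_of_apply Pi_def)
  next
    case (two_sided S)
    then show ?thesis
      using h assms(2) by (auto simp: chain_of_apply)
  qed
  then show ?thesis
    by (auto simp: bold_chains_simps chain_of_def)
qed

lemma point_part_chain_of:
  assumes "one_sided S" "a \<in> S" "int (card S) = i"
  shows "point_part i (chain_of i f m) a S = f a S"
  using assms point_gen[OF assms] one_sided_sub_V[of S] by (simp add: point_part_def chain_of_apply)

lemma total_chain_of:
  assumes "chain_of i f m \<in> carrier (bold_chains K G i)"
    and "S \<subseteq> verts G" "\<not> one_sided S" "int (card S) = i"
  shows "total i (chain_of i f m) S = m S"
  using assms two_sided_gen[OF assms(2-4)] by (simp add: total_two_sided chain_of_apply)

subsection \<open>The differential\<close>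

lemma bold_diff_closed:
  "c \<in> carrier (bold_chains K G i) \<Longrightarrow> bold_diff K G s i c \<in> carrier (bold_chains K G (i + 1))"
  by (rule mod_hom.f_im[OF bold_diff_mod_hom])

lemma card_remove:
  assumes "S \<subseteq> verts G" "v \<in> S"
  shows "int (card (S - {v})) = int (card S) - 1"
  using card.remove[OF finite_sub[OF assms(1)] assms(2)] by linarith

lemma point_part_diff:
  assumes c: "c \<in> carrier (bold_chains K G i)" and a: "a \<in> verts G" and S: "one_sided S"
  shows "point_part (i + 1) (bold_diff K G s i c) a S = cobd (point_part i c a) S"
proof (cases "int (card S) = i + 1 \<and> a \<in> S")
  case True
  have inner: "(\<Oplus>x\<in>{x \<in> components (G \<restriction> (S - {v})). verts x \<subseteq> verts (G \<restriction> {a})}. c (colouring (S - {v}), x))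
      = point_part i c a (S - {v})" if v: "v \<in> S" for v
  proof -
    have m: "one_sided (S - {v})" using one_sided_subset[OF S] by blast
    have deg: "int (card (S - {v})) = i"
      using card_remove[OF one_sided_sub_V[OF S] v] True by simp
    have "{x \<in> components (G \<restriction> (S - {v})). verts x \<subseteq> verts (G \<restriction> {a})}
        = (if a \<in> S - {v} then {G \<restriction> {a}} else {})"
      using components_one_sided[OF m] by auto
    then show ?thesis
      using bold_chain_value[OF c point_gen[OF m _ deg, of a]] m deg
      by (auto simp: point_part_def)
  qed
  have "point_part (i + 1) (bold_diff K G s i c) a S = bold_diff K G s i c (colouring S, G \<restriction> {a})"
    using True S by (simp add: point_part_def)
  also have "\<dots> = (\<Oplus>v\<in>S. edge_sign (S - {v}) v \<otimes> (\<Oplus>x\<in>{x \<in> components (G \<restriction> (S - {v})).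
      verts x \<subseteq> verts (G \<restriction> {a})}. c (colouring (S - {v}), x)))"
    using True S by (intro bold_diff_apply c one_sided_sub_V) (auto simp: components_one_sided)
  also have "\<dots> = cobd (point_part i c a) S"
    unfolding cobd_def using inner c
    by (intro finsum_cong') (auto simp: point_part_closed simp del: induce_subgraph_verts)
  finally show ?thesis .
next
  case False
  have "point_part i c a (S - {v}) = \<zero>" if v: "v \<in> S" for v
    using False card_remove[OF one_sided_sub_V[OF S] v] by (auto simp: point_part_def)
  then have "cobd (point_part i c a) S = \<zero>" by (rule cobd_eq_zero)
  then show ?thesis using False by (auto simp: point_part_def)
qed

lemma total_diff:
  assumes c: "c \<in> carrier (bold_chains K G i)" and S: "S \<subseteq> verts G"
  shows "total (i + 1) (bold_diff K G s i c) S = cobd (total i c) S"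
proof (cases "one_sided S")
  case True
  have "total (i + 1) (bold_diff K G s i c) S
      = (\<Oplus>a\<in>verts G. point_part (i + 1) (bold_diff K G s i c) a S)"
    using True c by (intro total_one_sided bold_diff_closed)
  also have "\<dots> = (\<Oplus>a\<in>verts G. cobd (point_part i c a) S)"
    using True c by (intro finsum_cong') (auto simp: point_part_diff point_part_closed intro!: cobd_closed)
  also have "\<dots> = cobd (\<lambda>T. \<Oplus>a\<in>verts G. point_part i c a T) S"
    using c finite_sub[OF S] by (intro cobd_finsum[symmetric]) (auto simp: point_part_closed)
  also have "\<dots> = cobd (total i c) S"
  proof (rule cobd_cong)
    fix v
    have "one_sided (S - {v})" using one_sided_subset[OF True] by blast
    then show "(\<Oplus>a\<in>verts G. point_part i c a (S - {v})) = total i c (S - {v})"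
      by (simp add: total_one_sided[OF c])
  qed (use c S in \<open>auto simp: total_closed\<close>)
  finally show ?thesis .
next
  case False
  show ?thesis
  proof (cases "int (card S) = i + 1")
    case True
    have "total (i + 1) (bold_diff K G s i c) S = bold_diff K G s i c (colouring S, G \<restriction> S)"
      using True False S c by (intro total_two_sided bold_diff_closed)
    also have "\<dots> = (\<Oplus>v\<in>S. edge_sign (S - {v}) v \<otimes> (\<Oplus>x\<in>{x \<in> components (G \<restriction> (S - {v})).
      verts x \<subseteq> verts (G \<restriction> S)}. c (colouring (S - {v}), x)))"
      using True False S by (intro bold_diff_apply c) (auto simp: components_two_sided)
    also have "\<dots> = cobd (total i c) S"
      unfolding cobd_def
    proof (intro finsum_cong')
      fix v assume v: "v \<in> S"
      have "verts x \<subseteq> S" if "x \<in> components (G \<restriction> (S - {v}))" for x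
        using that by (auto simp: components_def pre_digraph.max_subgraph_def subgraph_def)
      then have "{x \<in> components (G \<restriction> (S - {v})). verts x \<subseteq> verts (G \<restriction> S)}
          = components (G \<restriction> (S - {v}))" by auto
      then show "edge_sign (S - {v}) v \<otimes> (\<Oplus>x\<in>{x \<in> components (G \<restriction> (S - {v})).
          verts x \<subseteq> verts (G \<restriction> S)}. c (colouring (S - {v}), x))
        = edge_sign (S - {v}) v \<otimes> total i c (S - {v})"
        using card_remove[OF S v] True by (simp add: total_def)
    qed (use c S in \<open>auto simp: total_closed subset_iff\<close>)
    finally show ?thesis .
  next
    case False
    have "total i c (S - {v}) = \<zero>" if v: "v \<in> S" for v
      using False card_remove[OF S v] by (simp add: total_def)
    then have "cobd (total i c) S = \<zero>" by (rule cobd_eq_zero)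
    then show ?thesis using False by (simp add: total_def)
  qed
qed

end

section \<open>Bold homology of complete bipartite graphs\<close>

context bipartite_bold
begin

lemma point_part_zero: "point_part i \<zero>\<^bsub>bold_chains K G i\<^esub> a S = \<zero>"
  using point_gen[of S a i] by (auto simp: point_part_def bold_chains_simps)

lemma total_zero: "S \<subseteq> verts G \<Longrightarrow> total i \<zero>\<^bsub>bold_chains K G i\<^esub> S = \<zero>"
  by (auto simp: total_def bold_chains_simps mem_bold_gens intro!: add.finprod_one_eqI)

lemma bold_zero_closed: "\<zero>\<^bsub>bold_chains K G i\<^esub> \<in> carrier (bold_chains K G i)"
  by (simp add: bold_chains_simps)

lemma bold_diff_bold_diff:
  assumes c: "c \<in> carrier (bold_chains K G i)"
  shows "bold_diff K G s (i + 1) (bold_diff K G s i c) = \<zero>\<^bsub>bold_chains K G (i + 1 + 1)\<^esub>"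
proof (rule chain_eqI[OF _ bold_zero_closed])
  note dc = bold_diff_closed[OF c]
  show "bold_diff K G s (i + 1) (bold_diff K G s i c) \<in> carrier (bold_chains K G (i + 1 + 1))"
    by (rule bold_diff_closed[OF dc])
  fix a S assume S: "one_sided S" "a \<in> S"
  have a: "a \<in> verts G" using S one_sided_sub_V by auto
  have "point_part (i + 1 + 1) (bold_diff K G s (i + 1) (bold_diff K G s i c)) a S
      = cobd (point_part (i + 1) (bold_diff K G s i c) a) S"
    using S a by (intro point_part_diff dc)
  also have "\<dots> = cobd (cobd (point_part i c a)) S"
  proof (rule cobd_cong)
    fix v
    have "one_sided (S - {v})" using one_sided_subset[OF S(1)] by blast
    then show "point_part (i + 1) (bold_diff K G s i c) a (S - {v}) = cobd (point_part i c a) (S - {v})"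
      using a by (intro point_part_diff c)
  qed (use c in \<open>auto intro!: cobd_closed simp: point_part_closed\<close>)
  also have "\<dots> = \<zero>"
    using c one_sided_sub_V[OF S(1)] by (intro cobd_cobd) (auto simp: point_part_closed)
  finally show "point_part (i + 1 + 1) (bold_diff K G s (i + 1) (bold_diff K G s i c)) a S
      = point_part (i + 1 + 1) \<zero>\<^bsub>bold_chains K G (i + 1 + 1)\<^esub> a S"
    by (simp add: point_part_zero)
next
  note dc = bold_diff_closed[OF c]
  fix S assume S: "S \<subseteq> verts G"
  have "total (i + 1 + 1) (bold_diff K G s (i + 1) (bold_diff K G s i c)) S
      = cobd (total (i + 1) (bold_diff K G s i c)) S"
    using S by (intro total_diff dc)
  also have "\<dots> = cobd (cobd (total i c)) S"
  proof (rule cobd_cong)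
    fix v
    have "S - {v} \<subseteq> verts G" using S by blast
    then show "total (i + 1) (bold_diff K G s i c) (S - {v}) = cobd (total i c) (S - {v})"
      by (rule total_diff[OF c])
  next
    have "T \<subseteq> verts G" if "T \<subseteq> S" for T using S that by blast
    then show "cobd (total i c) \<in> Pow S \<rightarrow> carrier K"
      using c by (auto intro!: cobd_closed simp: total_closed)
  qed
  also have "\<dots> = \<zero>"
    using c S by (intro cobd_cobd) (auto simp: total_closed)
  finally show "total (i + 1 + 1) (bold_diff K G s (i + 1) (bold_diff K G s i c)) S
      = total (i + 1 + 1) \<zero>\<^bsub>bold_chains K G (i + 1 + 1)\<^esub> S"
    using S by (simp add: total_zero)
qed

lemma module_complex_bold:
  "module_complex K (bold_chains K G (i - 1)) (bold_chains K G i) (bold_chains K G (i + 1))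
    (bold_diff K G s (i - 1)) (bold_diff K G s i)"
  using bold_diff_mod_hom[of "i - 1"] bold_diff_mod_hom[of i] bold_diff_bold_diff[of _ "i - 1"]
  by (auto simp: module_complex_def module_complex_axioms_def)

lemma bold_homology_eq:
  "bold_homology K G s i = module_complex.homology
    (bold_chains K G (i - 1)) (bold_chains K G i) (bold_chains K G (i + 1))
    (bold_diff K G s (i - 1)) (bold_diff K G s i)"
  by (simp add: bold_homology_def module_complex.homology_def[OF module_complex_bold])

lemma diff_eq_zeroD:
  assumes c: "c \<in> carrier (bold_chains K G i)"
    and closed: "bold_diff K G s i c = \<zero>\<^bsub>bold_chains K G (i + 1)\<^esub>"
  shows "\<lbrakk>a \<in> verts G; one_sided S\<rbrakk> \<Longrightarrow> cobd (point_part i c a) S = \<zero>"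
    and "S \<subseteq> verts G \<Longrightarrow> cobd (total i c) S = \<zero>"
  using point_part_diff[OF c, of a S] total_diff[OF c, of S]
  by (simp_all add: closed point_part_zero total_zero)

subsection \<open>The generator\<close>

text \<open>
  The total of the generator is a coboundary in the cube, but this does not make the generator a
  boundary: the chain of degree one whose total is the vertex cochain has a differential that is also
  non-zero at the components of the two-element subsets of \<open>A\<close>.
\<close>

definition generator where
  "generator = chain_of 2 (\<lambda>a S. \<zero>) (cobd vertex_cochain)"

lemma generator_closed: "generator \<in> carrier (bold_chains K G 2)"
  unfolding generator_def using vertex_cochain_closed
  by (intro chain_of_closed) (auto intro!: cobd_closed)

lemma point_part_generator: "point_part 2 generator a S = \<zero>"
  using point_part_chain_of[of S a 2 "\<lambda>a S. \<zero>" "cobd vertex_cochain"] point_part_support[of S a 2 generator]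
  by (cases "one_sided S \<and> a \<in> S \<and> int (card S) = 2") (auto simp: generator_def point_part_def)

lemma total_generator:
  assumes S: "S \<subseteq> verts G"
  shows "total 2 generator S = cobd vertex_cochain S"
proof (cases "one_sided S")
  case True
  have "total 2 generator S = \<zero>"
    using total_one_sided[OF generator_closed True] by (simp add: point_part_generator)
  then show ?thesis
    using cobd_vertex_cochain_one_sided[OF True] by simp
next
  case False
  show ?thesis
  proof (cases "int (card S) = 2")
    case True
    then show ?thesis
      using total_chain_of[OF generator_closed[unfolded generator_def] S False]
      by (simp add: generator_def)
  next
    case False
    have "graded 2 (cobd vertex_cochain)"
      using graded_cobd[OF graded_vertex_cochain] by simp
    then show ?thesis
      using False S graded_total[of 2 generator] by (simp add: graded_def)
  qed
qed

lemma bold_diff_generator: "bold_diff K G s 2 generator = \<zero>\<^bsub>bold_chains K G (2 + 1)\<^esub>"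
proof (rule chain_eqI[OF bold_diff_closed[OF generator_closed] bold_zero_closed])
  fix a S assume S: "one_sided S" "a \<in> S"
  then have "point_part (2 + 1) (bold_diff K G s 2 generator) a S = cobd (point_part 2 generator a) S"
    using one_sided_sub_V by (intro point_part_diff generator_closed) auto
  also have "\<dots> = \<zero>" by (intro cobd_eq_zero point_part_generator)
  finally show "point_part (2 + 1) (bold_diff K G s 2 generator) a S
      = point_part (2 + 1) \<zero>\<^bsub>bold_chains K G (2 + 1)\<^esub> a S"
    by (simp only: point_part_zero)
next
  fix S assume S: "S \<subseteq> verts G"
  have "total (2 + 1) (bold_diff K G s 2 generator) S = cobd (total 2 generator) S"
    using S by (intro total_diff generator_closed)
  also have "\<dots> = cobd (cobd vertex_cochain) S"
  proof (rule cobd_cong)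
    show "total 2 generator (S - {v}) = cobd vertex_cochain (S - {v})" for v
      using S by (intro total_generator) auto
  qed (auto intro!: cobd_closed simp: vertex_cochain_closed)
  also have "\<dots> = \<zero>"
    using S by (intro cobd_cobd) (auto simp: vertex_cochain_closed)
  finally show "total (2 + 1) (bold_diff K G s 2 generator) S
      = total (2 + 1) \<zero>\<^bsub>bold_chains K G (2 + 1)\<^esub> S"
    using total_zero[OF S] by simp
qed

text \<open>
  The coefficient of \<open>bold_diff K G s 1 b\<close> at the component \<open>{v}\<close> of \<open>{v, partner v}\<close> is, up to sign,
  the coefficient of \<open>b\<close> at the vertex \<open>v\<close>. A boundary without point parts therefore comes from
  the zero chain.
\<close>

lemma generator_not_boundary: "generator \<notin> bold_diff K G s 1 ` carrier (bold_chains K G 1)"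
proof
  assume "generator \<in> bold_diff K G s 1 ` carrier (bold_chains K G 1)"
  then obtain b where b: "b \<in> carrier (bold_chains K G 1)" "generator = bold_diff K G s 1 b"
    by blast
  have vanish: "total 1 b {v} = \<zero>" if v: "v \<in> verts G" for v
  proof -
    let ?p = "partner v" and ?f = "point_part 1 b v"
    have m: "one_sided {v}" using v by (auto simp: one_sided_def V_eq)
    have m2: "one_sided {v, ?p}"
      using one_sided_insert_partner[OF m] by (simp add: insert_commute)
    have "\<zero> = point_part (1 + 1) (bold_diff K G s 1 b) v {v, ?p}"
      using point_part_generator[of v "{v, ?p}"] b(2) by simp
    also have "\<dots> = cobd ?f {v, ?p}"
      using b(1) v m2 by (rule point_part_diff)
    also have "\<dots> = edge_sign {?p} v \<otimes> ?f {?p} \<oplus> edge_sign {v} ?p \<otimes> ?f {v}"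
      using partner_neq[OF v] b(1) by (intro cobd_pair) (auto simp: point_part_closed)
    also have "?f {?p} = \<zero>"
      using partner_neq[OF v] by (intro point_part_support) auto
    finally have "edge_sign {v} ?p \<otimes> ?f {v} = \<zero>"
      using point_part_closed[OF b(1)] by simp
    then have "?f {v} = \<zero>"
      using e_cancel[of "?f {v}" "{v}" ?p] point_part_closed[OF b(1)] by simp
    moreover have "total 1 b {v} = (\<Oplus>a\<in>verts G. if a = v then ?f {v} else \<zero>)"
      unfolding total_one_sided[OF b(1) m] using point_part_closed[OF b(1)]
      by (intro finsum_cong') (auto simp: point_part_support)
    ultimately show ?thesis
      by (simp add: add.finprod_one_eqI)
  qed
  have "cobd (total 1 b) {a\<^sub>0, b\<^sub>0} = \<zero>"
    using vanish a0_V b0_V a0_b0 by (subst cobd_pair) auto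
  moreover have "cobd (total 1 b) {a\<^sub>0, b\<^sub>0} = total (1 + 1) generator {a\<^sub>0, b\<^sub>0}"
    unfolding b(2) using a0_V b0_V b(1) by (intro total_diff[symmetric]) auto
  moreover have "total (1 + 1) generator {a\<^sub>0, b\<^sub>0} = cobd vertex_cochain {a\<^sub>0, b\<^sub>0}"
    using total_generator[of "{a\<^sub>0, b\<^sub>0}"] a0_V b0_V by simp
  ultimately have "cobd vertex_cochain {a\<^sub>0, b\<^sub>0} = \<zero>" by simp
  from cobd_vertex_cochain_square[unfolded this] show False by simp
qed

subsection \<open>Cocycles\<close>

text \<open>
  The cochains that \<open>cocycle_decomposition\<close> provides are the coordinates of a chain one degree
  lower, with the cones as point parts and with the rest as values at the other sets.
\<close>

lemma cocycle_cases:
  assumes c: "c \<in> carrier (bold_chains K G i)"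
    and closed: "bold_diff K G s i c = \<zero>\<^bsub>bold_chains K G (i + 1)\<^esub>"
  obtains b t where "b \<in> carrier (bold_chains K G (i - 1))" "t \<in> carrier K" "i \<noteq> 2 \<Longrightarrow> t = \<zero>"
    "\<And>a S. a \<in> verts G \<Longrightarrow> one_sided S \<Longrightarrow> point_part i (bold_diff K G s (i - 1) b) a S = point_part i c a S"
    "\<And>S. S \<subseteq> verts G \<Longrightarrow>
      total i c S = total i (bold_diff K G s (i - 1) b) S \<oplus> t \<otimes> cobd vertex_cochain S"
proof (rule cocycle_decomposition[of "point_part i c" "total i c" i])
  fix \<psi> m t
  assume psi: "\<And>a. a \<in> verts G \<Longrightarrow> \<psi> a \<in> Pow (verts G) \<rightarrow> carrier K"
    and psi_supp: "\<And>a S. \<lbrakk>a \<in> verts G; S \<subseteq> verts G; \<not> (one_sided S \<and> a \<in> S)\<rbrakk> \<Longrightarrow> \<psi> a S = \<zero>"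
    and psi_deg: "\<And>a. a \<in> verts G \<Longrightarrow> graded (i - 1) (\<psi> a)"
    and psi_cobd: "\<And>a S. \<lbrakk>a \<in> verts G; one_sided S\<rbrakk> \<Longrightarrow> cobd (\<psi> a) S = point_part i c a S"
    and m: "m \<in> Pow (verts G) \<rightarrow> carrier K" "graded (i - 1) m" "\<And>S. one_sided S \<Longrightarrow> m S = \<zero>"
    and t: "t \<in> carrier K" "i \<noteq> 2 \<Longrightarrow> t = \<zero>"
    and tot: "\<And>S. S \<subseteq> verts G \<Longrightarrow> total i c S =
      cobd (\<lambda>T. m T \<oplus> (\<Oplus>a\<in>verts G. \<psi> a T)) S \<oplus> t \<otimes> cobd vertex_cochain S"
  define b where "b = chain_of (i - 1) \<psi> m"
  have b: "b \<in> carrier (bold_chains K G (i - 1))"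
    unfolding b_def by (intro chain_of_closed psi m)
  have pb: "point_part (i - 1) b a S = \<psi> a S" if a: "a \<in> verts G" and S: "one_sided S" for a S
  proof (cases "a \<in> S \<and> int (card S) = i - 1")
    case True
    then show ?thesis unfolding b_def using S by (intro point_part_chain_of) auto
  next
    case False
    then have "\<psi> a S = \<zero>"
      using psi_supp[OF a] psi_deg[OF a] one_sided_sub_V[OF S] unfolding graded_def by blast
    then show ?thesis using False by (auto simp: point_part_def)
  qed
  have tb: "total (i - 1) b S = m S \<oplus> (\<Oplus>a\<in>verts G. \<psi> a S)" if S: "S \<subseteq> verts G" for S
  proof (cases "one_sided S")
    case True
    have "total (i - 1) b S = (\<Oplus>a\<in>verts G. \<psi> a S)"
      unfolding total_one_sided[OF b True] using True pb psi S by (intro finsum_cong') (auto simp: Pi_def)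
    moreover have "(\<Oplus>a\<in>verts G. \<psi> a S) \<in> carrier K"
      using psi S by (intro finsum_closed) (auto simp: Pi_def)
    ultimately show ?thesis using m(3)[OF True] by simp
  next
    case False
    have "(\<Oplus>a\<in>verts G. \<psi> a S) = \<zero>"
      using psi_supp S False by (intro add.finprod_one_eqI) auto
    moreover have "total (i - 1) b S = m S"
    proof (cases "int (card S) = i - 1")
      case True
      then show ?thesis
        using total_chain_of[OF _ S False True] b unfolding b_def by blast
    next
      case False
      then show ?thesis
        using m(2) graded_total[of "i - 1" b] S by (simp add: graded_def)
    qed
    moreover have "m S \<in> carrier K" using m(1) S by auto
    ultimately show ?thesis by simp
  qed
  have "point_part i (bold_diff K G s (i - 1) b) a S = point_part i c a S"
    if a: "a \<in> verts G" and S: "one_sided S" for a S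
  proof -
    have "point_part (i - 1 + 1) (bold_diff K G s (i - 1) b) a S = cobd (point_part (i - 1) b a) S"
      using a S by (intro point_part_diff b)
    also have "\<dots> = cobd (\<psi> a) S"
    proof (rule cobd_cong)
      fix v
      have "one_sided (S - {v})" using one_sided_subset[OF S] by blast
      then show "point_part (i - 1) b a (S - {v}) = \<psi> a (S - {v})" by (rule pb[OF a])
    next
      show "\<psi> a \<in> Pow S \<rightarrow> carrier K"
        using psi[OF a] one_sided_sub_V[OF S] by auto
    qed
    also have "\<dots> = point_part i c a S" using a S by (rule psi_cobd)
    finally show ?thesis by simp
  qed
  moreover have "total i c S = total i (bold_diff K G s (i - 1) b) S \<oplus> t \<otimes> cobd vertex_cochain S"
    if S: "S \<subseteq> verts G" for S
  proof -
    have "total (i - 1 + 1) (bold_diff K G s (i - 1) b) S = cobd (total (i - 1) b) S"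
      using S by (intro total_diff b)
    also have "\<dots> = cobd (\<lambda>T. m T \<oplus> (\<Oplus>a\<in>verts G. \<psi> a T)) S"
    proof (rule cobd_cong)
      fix v
      have "S - {v} \<subseteq> verts G" using S by blast
      then show "total (i - 1) b (S - {v}) = m (S - {v}) \<oplus> (\<Oplus>a\<in>verts G. \<psi> a (S - {v}))"
        by (rule tb)
    next
      show "(\<lambda>T. m T \<oplus> (\<Oplus>a\<in>verts G. \<psi> a T)) \<in> Pow S \<rightarrow> carrier K"
        using m(1) psi S by (auto simp: Pi_def intro!: finsum_closed)
    qed
    finally show ?thesis using tot[OF S] by simp
  qed
  ultimately show thesis
    using that b t by blast
next
  fix a S
  show "\<lbrakk>a \<in> verts G; one_sided S\<rbrakk> \<Longrightarrow> cobd (point_part i c a) S = \<zero>"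
    "S \<subseteq> verts G \<Longrightarrow> cobd (total i c) S = \<zero>"
    by (rule diff_eq_zeroD[OF c closed]; assumption)+
  show "\<not> (one_sided S \<and> a \<in> S) \<Longrightarrow> point_part i c a S = \<zero>"
    by (rule point_part_support)
qed (use c in \<open>auto simp: point_part_closed total_closed graded_point_part graded_total
      intro: total_one_sided\<close>)

lemma cocycle_boundary:
  assumes c: "c \<in> carrier (bold_chains K G i)" and i: "i \<noteq> 2"
    and closed: "bold_diff K G s i c = \<zero>\<^bsub>bold_chains K G (i + 1)\<^esub>"
  shows "c \<in> bold_diff K G s (i - 1) ` carrier (bold_chains K G (i - 1))"
proof (rule cocycle_cases[OF c closed])
  fix b t
  assume b: "b \<in> carrier (bold_chains K G (i - 1))"
    and t: "i \<noteq> 2 \<Longrightarrow> t = \<zero>"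
    and point: "\<And>a S. a \<in> verts G \<Longrightarrow> one_sided S \<Longrightarrow>
      point_part i (bold_diff K G s (i - 1) b) a S = point_part i c a S"
    and tot: "\<And>S. S \<subseteq> verts G \<Longrightarrow>
      total i c S = total i (bold_diff K G s (i - 1) b) S \<oplus> t \<otimes> cobd vertex_cochain S"
  have db: "bold_diff K G s (i - 1) b \<in> carrier (bold_chains K G i)"
    using bold_diff_closed[OF b] by simp
  have "cobd vertex_cochain S \<in> carrier K" for S
    by (intro cobd_closed) (auto simp: vertex_cochain_closed)
  then have "total i c S = total i (bold_diff K G s (i - 1) b) S" if "S \<subseteq> verts G" for S
    using tot[OF that] t[OF i] total_closed[OF db that] by simp
  then have "c = bold_diff K G s (i - 1) b"
    using point[symmetric] one_sided_sub_V by (intro chain_eqI[OF c db]) blast+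
  then show ?thesis using b by blast
qed

lemma cocycle_degree_two:
  assumes c: "c \<in> carrier (bold_chains K G 2)"
    and closed: "bold_diff K G s 2 c = \<zero>\<^bsub>bold_chains K G (2 + 1)\<^esub>"
  shows "\<exists>b\<in>carrier (bold_chains K G (2 - 1)). \<exists>t\<in>carrier K.
    c = bold_diff K G s (2 - 1) b \<oplus>\<^bsub>bold_chains K G 2\<^esub> t \<odot>\<^bsub>bold_chains K G 2\<^esub> generator"
proof (rule cocycle_cases[OF c closed])
  fix b t
  assume b: "b \<in> carrier (bold_chains K G (2 - 1))" and t: "t \<in> carrier K"
    and point: "\<And>a S. a \<in> verts G \<Longrightarrow> one_sided S \<Longrightarrow>
      point_part 2 (bold_diff K G s (2 - 1) b) a S = point_part 2 c a S"
    and tot: "\<And>S. S \<subseteq> verts G \<Longrightarrow>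
      total 2 c S = total 2 (bold_diff K G s (2 - 1) b) S \<oplus> t \<otimes> cobd vertex_cochain S"
  define db where "db = bold_diff K G s (2 - 1) b"
  let ?C = "bold_chains K G 2"
  interpret C: module K ?C by (rule bold_chains_module)
  have db: "db \<in> carrier ?C"
    unfolding db_def using bold_diff_closed[OF b] by simp
  have rhs: "db \<oplus>\<^bsub>?C\<^esub> t \<odot>\<^bsub>?C\<^esub> generator \<in> carrier ?C"
    using db t generator_closed by (intro C.a_closed C.smult_closed)
  have eval: "(db \<oplus>\<^bsub>?C\<^esub> t \<odot>\<^bsub>?C\<^esub> generator) h = db h \<oplus> t \<otimes> generator h"
    if "h \<in> bold_gens G 2" for h
    using that by (simp add: bold_chains_simps)
  have "c = db \<oplus>\<^bsub>?C\<^esub> t \<odot>\<^bsub>?C\<^esub> generator"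
  proof (rule chain_eqI[OF c rhs])
    fix a S assume S: "one_sided S" "a \<in> S" "int (card S) = 2"
    then have "point_part 2 (db \<oplus>\<^bsub>?C\<^esub> t \<odot>\<^bsub>?C\<^esub> generator) a S
        = point_part 2 db a S \<oplus> t \<otimes> point_part 2 generator a S"
      using point_gen[OF S] by (simp add: point_part_def eval)
    also have "\<dots> = point_part 2 c a S"
      using S one_sided_sub_V[OF S(1)] t point[of a S, folded db_def] point_part_closed[OF c]
      by (auto simp: point_part_generator)
    finally show "point_part 2 c a S = point_part 2 (db \<oplus>\<^bsub>?C\<^esub> t \<odot>\<^bsub>?C\<^esub> generator) a S" ..
  next
    fix S assume S: "S \<subseteq> verts G" "\<not> one_sided S" "int (card S) = 2"
    have "total 2 (db \<oplus>\<^bsub>?C\<^esub> t \<odot>\<^bsub>?C\<^esub> generator) S = total 2 db S \<oplus> t \<otimes> total 2 generator S"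
      using S two_sided_gen[OF S] by (simp add: total_two_sided rhs db generator_closed eval)
    also have "\<dots> = total 2 c S"
      using S tot[folded db_def] by (simp add: total_generator)
    finally show "total 2 c S = total 2 (db \<oplus>\<^bsub>?C\<^esub> t \<odot>\<^bsub>?C\<^esub> generator) S" ..
  qed
  then show ?thesis using b t unfolding db_def by blast
qed

lemma bold_homology_other:
  assumes "i \<noteq> 2"
  shows "carrier (bold_homology K G s i) = {\<zero>\<^bsub>bold_homology K G s i\<^esub>}"
  unfolding bold_homology_eq
  using module_complex.homology_trivial[OF module_complex_bold] cocycle_boundary assms by blast

lemma bold_homology_two:
  "vectorspace K (bold_homology K G s 2)"
  "vectorspace.fin_dim K (bold_homology K G s 2)"
  "vectorspace.dim K (bold_homology K G s 2) = 1"
proof -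
  have "generator \<notin> bold_diff K G s (2 - 1) ` carrier (bold_chains K G (2 - 1))"
    using generator_not_boundary by simp
  note hom = module_complex.homology_one_dimensional[OF module_complex_bold field_axioms
      generator_closed bold_diff_generator this cocycle_degree_two]
  show "vectorspace K (bold_homology K G s 2)"
    "vectorspace.fin_dim K (bold_homology K G s 2)"
    "vectorspace.dim K (bold_homology K G s 2) = 1"
    unfolding bold_homology_eq by (rule hom; assumption)+
qed

end

theorem proposition5p7:
  fixes K :: "('k, 'c) ring_scheme"
    and G :: "('a, 'b) pre_digraph"
    and s :: "('a \<Rightarrow> nat) \<Rightarrow> ('a \<Rightarrow> nat) \<Rightarrow> bit"
    and m n :: nat
  assumes "field K"
    and "m \<ge> 2" and "n \<ge> 2"
    and "K\<^bsub>n,m\<^esub> G"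
    and "sign_assignment G s"
  shows "vectorspace K (bold_homology K G s 2) \<and>
         vectorspace.fin_dim K (bold_homology K G s 2) \<and>
         vectorspace.dim K (bold_homology K G s 2) = 1 \<and>
         (\<forall>i. i \<noteq> 2 \<longrightarrow>
            carrier (bold_homology K G s i) = {\<zero>\<^bsub>bold_homology K G s i\<^esub>})"
proof -
  obtain A B where AB: "graph G" "verts G = A \<union> B" "A \<inter> B = {}" "card A = n" "card B = m"
    "arcs_ends G = A \<times> B \<union> B \<times> A"
    using assms(4) unfolding complete_bipartite_digraph_def by blast
  have other: "\<exists>w. w \<in> X - {v}" if "card X \<ge> 2" for X :: "'a set" and v
  proof (rule ccontr)
    assume "\<nexists>w. w \<in> X - {v}"
    then have "X \<subseteq> {v}" by auto
    then have "card X \<le> card {v}" by (intro card_mono) auto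
    with that show False by simp
  qed
  define partner where "partner v = (SOME w. w \<in> (if v \<in> A then A else B) - {v})" for v
  have pA: "partner v \<in> A - {v}" if "v \<in> A" for v
    using someI_ex[OF other[of A v]] that AB(4) assms(3) by (simp add: partner_def)
  have pB: "partner v \<in> B - {v}" if "v \<in> B" for v
  proof -
    have "v \<notin> A" using that AB(3) by auto
    then show ?thesis
      using someI_ex[OF other[of B v]] AB(5) assms(2) by (simp add: partner_def)
  qed
  obtain a b where "a \<in> A" "b \<in> B"
    using AB(4,5) assms(2,3) by fastforce
  then interpret bipartite_bold K G s A B a b partner
    using AB assms pA pB
    by (intro bipartite_bold.intro bold_complex.intro bold_complex_axioms.intro
        bipartite_bold_axioms.intro)
  show ?thesis
    using bold_homology_two bold_homology_other by blast
qed

end
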